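(* Let $n\ge 1$, let $B$ be a commutative associative finitely generated unital algebra over $\mathbb C$, and let $\tau=(A\rtimes \mathrm{Der}A)\otimes B$ where $A=\mathbb C[t_1^{\pm1},\dots,t_n^{\pm1}]$. Let $V$ be an irreducible weight module for $\tau$ with finite dimensional weight spaces. Assume that the action of $A\otimes B$ on $V$ is associative and that $1.v=v$ for all $v\in V$. Then $V$ is an irreducible module for $A\rtimes\mathrm{Der}A$.
   Context: All vector spaces, algebras and tensor products are over $\mathbb C$. $(\cdot,\cdot)$ is the bilinear form on $\mathbb C^n$ with $(e_i,e_j)=\delta_{ij}$. For $r\in\mathbb Z^n$, $t^r=t_1^{r_1}\cdots t_n^{r_n}\in A$. $\mathrm{Der}A$ is the Lie algebra of derivations of $A$; for $u\in\mathbb C^n$, $r\in\mathbb Z^n$, $D(u,r)=\sum_i u_i t^r t_i\frac{d}{dt_i}$, and $[D(u,r),D(v,s)]=D(w,r+s)$ with $w=(u,s)v-(v,r)u$. $A\rtimes\mathrm{Der}A$ is the Lie algebra with additional brackets $[t^r,t^s]=0$, $[D(u,r),t^s]=(u,s)t^{r+s}$. $\tau=(A\rtimes \mathrm{Der}A)\otimes B$ has bracket $[X\otimes b,Y\otimes b']=[X,Y]\otimes bb'$; write $t^rb=t^r\otimes b$. $V$ is regarded as a module over $A\rtimes\mathrm{Der}A$ through the subalgebra $(A\rtimes\mathrm{Der}A)\otimes 1\subset\tau$. Let $\mathfrak h=\mathrm{span}\{D(u,0):u\in\mathbb C^n\}$ and $H=\mathbb C\,t^0\oplus\mathfrak h$,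 identified with $H\otimes 1\subset\tau$. A $\tau$-module $V$ is a weight module if $V=\bigoplus_{\lambda\in H^*}V_\lambda$ with $V_\lambda=\{v\in V:hv=\lambda(h)v\ \forall h\in H\}$; the $V_\lambda$ are the weight spaces. The action of $A\otimes B$ is associative if $(t^rb).((t^sb').v)=(t^{r+s}bb').v$ for all $r,s,b,b',v$; the $1$ in $1.v=v$ is $t^0\otimes 1$. *)

theory Defs
  imports "HOL-Analysis.Finite_Cartesian_Product" "HOL-Library.Poly_Mapping"
begin

section \<open>Complex vector spaces, algebras and Lie algebras\<close>

class scaleC =
  fixes scaleC :: "complex \<Rightarrow> 'a \<Rightarrow> 'a" (infixr \<open>*\<^sub>C\<close> 75)

class complex_vector = scaleC + ab_group_add +
  assumes scaleC_add_right: "a *\<^sub>C (x + y) = a *\<^sub>C x + a *\<^sub>C y"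
    and scaleC_add_left: "(a + b) *\<^sub>C x = a *\<^sub>C x + b *\<^sub>C x"
    and scaleC_scaleC: "a *\<^sub>C b *\<^sub>C x = (a * b) *\<^sub>C x"
    and scaleC_one: "1 *\<^sub>C x = x"

global_interpretation complex_vector:
  vector_space "scaleC :: complex \<Rightarrow> 'a \<Rightarrow> 'a :: complex_vector"
  by unfold_locales (simp_all add: scaleC_add_right scaleC_add_left scaleC_scaleC scaleC_one)

abbreviation clinear :: "('a::complex_vector \<Rightarrow> 'b::complex_vector) \<Rightarrow> bool"
  where "clinear \<equiv> Vector_Spaces.linear scaleC scaleC"

lemma clinear_iff:
  "clinear f \<longleftrightarrow> (\<forall>x y. f (x + y) = f x + f y) \<and> (\<forall>c x. f (c *\<^sub>C x) = c *\<^sub>C f x)"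
  by (simp add: Vector_Spaces.linear_iff complex_vector.vector_space_axioms)

definition cbilinear :: "('a::complex_vector \<Rightarrow> 'b::complex_vector \<Rightarrow> 'c::complex_vector) \<Rightarrow> bool"
  where "cbilinear h \<longleftrightarrow> (\<forall>x. clinear (h x)) \<and> (\<forall>y. clinear (\<lambda>x. h x y))"

text \<open>Commutative associative unital algebras. The class \<^class>\<open>comm_ring_1\<close> would in addition
  demand \<open>0 \<noteq> 1\<close>; here the zero algebra is admitted.\<close>

class complex_comm_algebra = complex_vector + comm_ring + comm_monoid_mult +
  assumes scaleC_mult_left: "(c *\<^sub>C x) * y = c *\<^sub>C (x * y)"

inductive_set subalgebra_generated :: "'a::complex_comm_algebra set \<Rightarrow> 'a set" for S
  where
    "x \<in> S \<Longrightarrow> x \<in> subalgebra_generated S"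
  | "1 \<in> subalgebra_generated S"
  | "x \<in> subalgebra_generated S \<Longrightarrow> y \<in> subalgebra_generated S \<Longrightarrow> x + y \<in> subalgebra_generated S"
  | "x \<in> subalgebra_generated S \<Longrightarrow> y \<in> subalgebra_generated S \<Longrightarrow> x * y \<in> subalgebra_generated S"
  | "x \<in> subalgebra_generated S \<Longrightarrow> c *\<^sub>C x \<in> subalgebra_generated S"

definition finitely_generated_algebra :: "'a::complex_comm_algebra itself \<Rightarrow> bool"
  where "finitely_generated_algebra _ \<longleftrightarrow>
    (\<exists>S :: 'a set. finite S \<and> subalgebra_generated S = UNIV)"

class lie_bracket =
  fixes lie_bracket :: "'a \<Rightarrow> 'a \<Rightarrow> 'a" (\<open>\<lbrakk>_,/ _\<rbrakk>\<^sub>L\<close>)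

class complex_lie_algebra = complex_vector + lie_bracket +
  assumes lie_add_right: "\<lbrakk>x, y + z\<rbrakk>\<^sub>L = \<lbrakk>x, y\<rbrakk>\<^sub>L + \<lbrakk>x, z\<rbrakk>\<^sub>L"
    and lie_scaleC_right: "\<lbrakk>x, c *\<^sub>C y\<rbrakk>\<^sub>L = c *\<^sub>C \<lbrakk>x, y\<rbrakk>\<^sub>L"
    and lie_add_left: "\<lbrakk>x + y, z\<rbrakk>\<^sub>L = \<lbrakk>x, z\<rbrakk>\<^sub>L + \<lbrakk>y, z\<rbrakk>\<^sub>L"
    and lie_scaleC_left: "\<lbrakk>c *\<^sub>C x, y\<rbrakk>\<^sub>L = c *\<^sub>C \<lbrakk>x, y\<rbrakk>\<^sub>L"
    and lie_alternating: "\<lbrakk>x, x\<rbrakk>\<^sub>L = 0"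
    and lie_jacobi: "\<lbrakk>x, \<lbrakk>y, z\<rbrakk>\<^sub>L\<rbrakk>\<^sub>L + \<lbrakk>y, \<lbrakk>z, x\<rbrakk>\<^sub>L\<rbrakk>\<^sub>L + \<lbrakk>z, \<lbrakk>x, y\<rbrakk>\<^sub>L\<rbrakk>\<^sub>L = 0"

lemma lie_antisym: "\<lbrakk>x, y\<rbrakk>\<^sub>L = - \<lbrakk>y, x\<rbrakk>\<^sub>L" for x :: "'a::complex_lie_algebra"
proof -
  have "\<lbrakk>x + y, x + y\<rbrakk>\<^sub>L = 0" by (rule lie_alternating)
  moreover have "\<lbrakk>x + y, x + y\<rbrakk>\<^sub>L = \<lbrakk>x, y\<rbrakk>\<^sub>L + \<lbrakk>y, x\<rbrakk>\<^sub>L"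
    by (subst lie_add_left, subst (1 2) lie_add_right) (simp add: lie_alternating)
  ultimately have "\<lbrakk>x, y\<rbrakk>\<^sub>L + \<lbrakk>y, x\<rbrakk>\<^sub>L = 0" by metis
  then show ?thesis
    by (simp add: eq_neg_iff_add_eq_0)
qed

instantiation complex :: complex_vector
begin
definition "scaleC_complex (c::complex) (x::complex) = c * x"
instance by standard (simp_all add: scaleC_complex_def algebra_simps)
end

instantiation poly_mapping :: (type, complex_vector) complex_vector
begin
definition "scaleC_poly_mapping c (f :: 'a \<Rightarrow>\<^sub>0 'b) = Poly_Mapping.map ((*\<^sub>C) c) f"
lemma lookup_scaleC:
  "Poly_Mapping.lookup (c *\<^sub>C f) k = c *\<^sub>C Poly_Mapping.lookup (f :: 'a \<Rightarrow>\<^sub>0 'b) k"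
  by (simp add: scaleC_poly_mapping_def map.rep_eq when_def)
instance
  by standard (rule poly_mapping_eqI; simp add: lookup_scaleC lookup_add
    scaleC_add_right scaleC_add_left scaleC_scaleC scaleC_one)+
end

lemma poly_mapping_add_induct [case_names zero single add]:
  assumes "P 0" "\<And>k c. P (Poly_Mapping.single k c)" "\<And>f g. P f \<Longrightarrow> P g \<Longrightarrow> P (f + g)"
  shows "P (f :: 'a \<Rightarrow>\<^sub>0 'b::ab_group_add)"
proof (induction f rule: update_induct)
  case const
  have "(0 :: 'a \<Rightarrow>\<^sub>0 'b) = Poly_Mapping.Abs_poly_mapping (\<lambda>_. 0)" by simp
  with assms(1) show ?case by simp
next
  case (update f a b)
  have "Poly_Mapping.update a b f = f + Poly_Mapping.single a b"
    using update
    by (intro poly_mapping_eqI)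
      (auto simp: lookup_update lookup_add lookup_single when_def in_keys_iff)
  with assms(2,3) update show ?case by simp
qed

section \<open>Laurent polynomials and their derivations\<close>

text \<open>The algebra \<open>A\<close> of Laurent polynomials in \<open>n = CARD('n)\<close> variables: the group algebra
  of \<open>\<int>\<^sup>n\<close>, with the convolution product of \<^type>\<open>poly_mapping\<close>.\<close>

type_synonym 'n laurent = "(int ^ 'n) \<Rightarrow>\<^sub>0 complex"

definition tpow :: "int ^ 'n \<Rightarrow> 'n::finite laurent"
  where "tpow r = Poly_Mapping.single r 1"

lemma lookup_scaleC_laurent:
  "Poly_Mapping.lookup (c *\<^sub>C f) k = c * Poly_Mapping.lookup (f :: 'n::finite laurent) k"
  by (simp add: lookup_scaleC scaleC_complex_def)

lemma scaleC_single:
  "c *\<^sub>C Poly_Mapping.single k d = (Poly_Mapping.single k (c *\<^sub>C d) :: 'a \<Rightarrow>\<^sub>0 'b::complex_vector)"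
  by (rule poly_mapping_eqI) (simp add: lookup_scaleC lookup_single when_def)

lemma scaleC_laurent_mult_left: "(c *\<^sub>C f) * g = c *\<^sub>C (f * (g :: 'n::finite laurent))"
proof -
  have "c *\<^sub>C h = Poly_Mapping.single 0 c * h" for h :: "'n laurent"
    using mult_map_scale_conv_mult[of c h]
    by (simp add: scaleC_poly_mapping_def scaleC_complex_def[abs_def])
  then show ?thesis by (simp add: mult.assoc)
qed

lemma scaleC_laurent_mult_right: "f * (c *\<^sub>C g) = c *\<^sub>C (f * (g :: 'n::finite laurent))"
  by (metis mult.commute scaleC_laurent_mult_left)

definition derivation :: "('n::finite laurent \<Rightarrow> 'n laurent) \<Rightarrow> bool"
  where "derivation d \<longleftrightarrow> clinear d \<and> (\<forall>f g. d (f * g) = d f * g + f * d g)"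

lemma derivation_iff:
  "derivation d \<longleftrightarrow> (\<forall>f g. d (f + g) = d f + d g) \<and> (\<forall>c f. d (c *\<^sub>C f) = c *\<^sub>C d f)
     \<and> (\<forall>f g. d (f * g) = d f * g + f * d g)"
  by (auto simp: derivation_def clinear_iff)

lemma derivation_zero: "derivation (\<lambda>_. 0)"
  by (simp add: derivation_iff)

lemma derivation_add: "derivation d \<Longrightarrow> derivation e \<Longrightarrow> derivation (\<lambda>f. d f + e f)"
  by (simp add: derivation_iff algebra_simps scaleC_add_right)

lemma derivation_uminus: "derivation d \<Longrightarrow> derivation (\<lambda>f. - d f)"
  by (simp add: derivation_iff algebra_simps)

lemma derivation_diff: "derivation d \<Longrightarrow> derivation e \<Longrightarrow> derivation (\<lambda>f. d f - e f)"
  by (simp add: derivation_iff algebra_simps complex_vector.scale_right_diff_distrib)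

lemma derivation_mult: "derivation d \<Longrightarrow> derivation (\<lambda>f. g * d f)"
  by (simp add: derivation_iff algebra_simps scaleC_laurent_mult_right)

lemma derivation_scaleC: "derivation d \<Longrightarrow> derivation (\<lambda>f. c *\<^sub>C d f)"
  by (simp add: derivation_iff scaleC_add_right scaleC_scaleC mult.commute
      scaleC_laurent_mult_left scaleC_laurent_mult_right)

lemma derivation_sum: "(\<And>i. i \<in> I \<Longrightarrow> derivation (d i)) \<Longrightarrow> derivation (\<lambda>f. \<Sum>i\<in>I. d i f)"
  by (induction I rule: infinite_finite_induct) (simp_all add: derivation_zero derivation_add)

lemma derivation_diff_eq: "derivation d \<Longrightarrow> d (f - g) = d f - d g"
  by (metis add_diff_cancel_right' derivation_iff diff_add_cancel)

lemma derivation_commutator: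
  assumes "derivation d" "derivation e"
  shows "derivation (\<lambda>f. d (e f) - e (d f))"
  using assms by (simp add: derivation_iff algebra_simps complex_vector.scale_right_diff_distrib)

typedef (overloaded) 'n der = "{d :: 'n::finite laurent \<Rightarrow> 'n laurent. derivation d}"
  morphisms der_apply Abs_der
  using derivation_zero by blast

setup_lifting type_definition_der

lemma der_eqI: "(\<And>f. der_apply d f = der_apply e f) \<Longrightarrow> d = e"
  by (metis der_apply_inject ext)

lemma derivation_der_apply: "derivation (der_apply d)"
  using der_apply by blast

instantiation der :: (finite) complex_lie_algebra
begin

lift_definition zero_der :: "'a der" is "\<lambda>_. 0" by (rule derivation_zero)
lift_definition plus_der :: "'a der \<Rightarrow> 'a der \<Rightarrow> 'a der" is "\<lambda>d e f. d f + e f"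
  by (rule derivation_add)
lift_definition minus_der :: "'a der \<Rightarrow> 'a der \<Rightarrow> 'a der" is "\<lambda>d e f. d f - e f"
  by (rule derivation_diff)
lift_definition uminus_der :: "'a der \<Rightarrow> 'a der" is "\<lambda>d f. - d f"
  by (rule derivation_uminus)
lift_definition scaleC_der :: "complex \<Rightarrow> 'a der \<Rightarrow> 'a der" is "\<lambda>c d f. c *\<^sub>C d f"
  by (rule derivation_scaleC)
lift_definition lie_bracket_der :: "'a der \<Rightarrow> 'a der \<Rightarrow> 'a der" is "\<lambda>d e f. d (e f) - e (d f)"
  by (rule derivation_commutator)

instance
proof (standard, goal_cases)
  case (15 x y z)
  show ?case
    by (rule der_eqI)
      (simp add: plus_der.rep_eq zero_der.rep_eq lie_bracket_der.rep_eq
        derivation_diff_eq[OF derivation_der_apply])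
qed (transfer; simp add: derivation_iff algebra_simps scaleC_add_right scaleC_add_left
    scaleC_scaleC scaleC_one complex_vector.scale_right_diff_distrib)+

end

definition dot :: "complex ^ 'n \<Rightarrow> int ^ 'n \<Rightarrow> complex"
  where "dot u r = (\<Sum>i\<in>UNIV. u $ i * of_int (r $ i))"

text \<open>The operator \<open>t\<^sub>i d/dt\<^sub>i\<close>, which multiplies the coefficient of \<open>t\<^sup>s\<close> by \<open>s\<^sub>i\<close>.\<close>

definition euler :: "'n \<Rightarrow> 'n::finite laurent \<Rightarrow> 'n laurent"
  where "euler i f = Poly_Mapping.mapp (\<lambda>s c. of_int (s $ i) * c) f"

lemma lookup_euler:
  "Poly_Mapping.lookup (euler i f) s = of_int (s $ i) * Poly_Mapping.lookup f s"
  by (auto simp: euler_def lookup_mapp when_def in_keys_iff)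

lemma euler_add: "euler i (f + g) = euler i f + euler i g"
  by (rule poly_mapping_eqI) (simp add: lookup_euler lookup_add algebra_simps)

lemma euler_single: "euler i (Poly_Mapping.single s c) = Poly_Mapping.single s (of_int (s $ i) * c)"
  by (rule poly_mapping_eqI) (simp add: lookup_euler lookup_single when_def)

lemma derivation_euler: "derivation (euler i)"
proof -
  have "euler i (f * g) = euler i f * g + f * euler i g" for f g
  proof (induction f rule: poly_mapping_add_induct)
    case zero
    have "euler i 0 = 0" by (rule poly_mapping_eqI) (simp add: lookup_euler)
    then show ?case by simp
  next
    case (single k c)
    show ?case
    proof (induction g rule: poly_mapping_add_induct)
      case zero
      have "euler i 0 = 0" by (rule poly_mapping_eqI) (simp add: lookup_euler)
      then show ?case by simp
    next
      case (single l d)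
      show ?case by (simp add: euler_single mult_single flip: single_add) (simp add: algebra_simps)
    next
      case (add g h)
      then show ?case by (simp add: euler_add distrib_left)
    qed
  next
    case (add f h)
    then show ?case by (simp add: euler_add distrib_right)
  qed
  moreover have "euler i (c *\<^sub>C f) = c *\<^sub>C euler i f" for c f
    by (rule poly_mapping_eqI) (simp add: lookup_euler lookup_scaleC_laurent)
  ultimately show ?thesis by (simp add: derivation_iff euler_add)
qed

lift_definition D :: "complex ^ 'n \<Rightarrow> int ^ 'n \<Rightarrow> 'n::finite der"
  is "\<lambda>u r f. \<Sum>i\<in>UNIV. (u $ i) *\<^sub>C (tpow r * euler i f)"
  by (intro derivation_sum derivation_scaleC derivation_mult derivation_euler)

lemma D_tpow: "der_apply (D u r) (tpow s) = dot u s *\<^sub>C tpow (r + s)"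
proof -
  have "der_apply (D u r) (tpow s)
      = (\<Sum>i\<in>UNIV. Poly_Mapping.single (r + s) (u $ i * of_int (s $ i)))"
    by (simp add: D.rep_eq tpow_def euler_single mult_single scaleC_single scaleC_complex_def)
  also have "\<dots> = Poly_Mapping.single (r + s) (dot u s)"
  proof -
    have "(\<Sum>i\<in>I. Poly_Mapping.single (r + s) (u $ i * of_int (s $ i)))
        = Poly_Mapping.single (r + s) (\<Sum>i\<in>I. u $ i * of_int (s $ i))" for I
      by (induction I rule: infinite_finite_induct) (simp_all add: single_add)
    then show ?thesis by (simp add: dot_def)
  qed
  finally show ?thesis by (simp add: tpow_def scaleC_single scaleC_complex_def)
qed

lemma derivation_eqI_tpow:
  assumes "derivation d" "derivation e" "\<And>s. d (tpow s) = e (tpow s)"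
  shows "d f = e f"
proof (induction f rule: poly_mapping_add_induct)
  case zero
  from derivation_diff_eq[OF assms(1), of 0 0] derivation_diff_eq[OF assms(2), of 0 0]
  show ?case by simp
next
  case (single k c)
  have *: "Poly_Mapping.single k c = c *\<^sub>C tpow k"
    by (simp add: tpow_def scaleC_single scaleC_complex_def)
  show ?case using assms unfolding * by (simp add: derivation_iff)
next
  case (add f g)
  then show ?case using assms by (simp add: derivation_iff)
qed

lemma dot_add: "dot u (r + s) = dot u r + dot u s"
  by (simp add: dot_def algebra_simps sum.distrib)

lemma dot_diff_scale:
  "dot ((\<chi> i. a * v $ i - b * u $ i)) s = a * dot v s - b * dot u s"
  by (simp add: dot_def algebra_simps sum_subtractf sum_distrib_left)

lemma lie_bracket_D:
  "\<lbrakk>D u r, D v s\<rbrakk>\<^sub>L = D (\<chi> i. dot u s * v $ i - dot v r * u $ i) (r + s)"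
proof (rule der_eqI, rule derivation_eqI_tpow[OF derivation_der_apply derivation_der_apply])
  fix k
  have lin: "der_apply d (c *\<^sub>C f) = c *\<^sub>C der_apply d f" for d :: "'a der" and c f
    using derivation_der_apply[of d] by (simp add: derivation_iff)
  define w where "w = (\<chi> i. dot u s * v $ i - dot v r * u $ i)"
  have w: "dot w k = dot u s * dot v k - dot v r * dot u k"
    by (simp add: w_def dot_diff_scale)
  show "der_apply \<lbrakk>D u r, D v s\<rbrakk>\<^sub>L (tpow k) = der_apply (D w (r + s)) (tpow k)"
    by (simp add: lie_bracket_der.rep_eq D_tpow lin w scaleC_scaleC dot_add
        algebra_simps flip: complex_vector.scale_left_diff_distrib)
qed

section \<open>The semidirect product of \<open>A\<close> and \<open>Der A\<close>\<close>

datatype 'n ader = ADer (fun_part: "'n::finite laurent") (der_part: "'n der")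

abbreviation inA :: "'n::finite laurent \<Rightarrow> 'n ader" where "inA f \<equiv> ADer f 0"
abbreviation inDer :: "'n::finite der \<Rightarrow> 'n ader" where "inDer d \<equiv> ADer 0 d"

instantiation ader :: (finite) complex_lie_algebra
begin

definition "0 = ADer 0 0"
definition "x + y = ADer (fun_part x + fun_part y) (der_part x + der_part y)"
definition "x - y = ADer (fun_part x - fun_part y) (der_part x - der_part y)"
definition "- x = ADer (- fun_part x) (- der_part x)"
definition "c *\<^sub>C x = ADer (c *\<^sub>C fun_part x) (c *\<^sub>C der_part x)"
definition "\<lbrakk>x, y\<rbrakk>\<^sub>L = ADer (der_apply (der_part x) (fun_part y) - der_apply (der_part y) (fun_part x))
  \<lbrakk>der_part x, der_part y\<rbrakk>\<^sub>L"

lemmas ader_defs = zero_ader_def plus_ader_def minus_ader_def uminus_ader_def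
  scaleC_ader_def lie_bracket_ader_def

instance
proof (standard, goal_cases)
  case (15 x y z)
  show ?case
    by (simp add: ader_defs lie_jacobi lie_bracket_der.rep_eq
        derivation_diff_eq[OF derivation_der_apply])
next
  case (10 x y z)
  show ?case using derivation_der_apply[of "der_part x"]
    by (simp add: ader_defs derivation_iff plus_der.rep_eq lie_add_right)
next
  case (11 x c y)
  show ?case using derivation_der_apply[of "der_part x"]
    by (simp add: ader_defs derivation_iff scaleC_der.rep_eq lie_scaleC_right
        complex_vector.scale_right_diff_distrib)
next
  case (12 x y z)
  show ?case using derivation_der_apply[of "der_part z"]
    by (simp add: ader_defs derivation_iff plus_der.rep_eq lie_add_left)
next
  case (13 c x y)
  show ?case using derivation_der_apply[of "der_part y"]
    by (simp add: ader_defs derivation_iff scaleC_der.rep_eq lie_scaleC_left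
        complex_vector.scale_right_diff_distrib)
qed (simp_all add: ader_defs scaleC_add_right scaleC_add_left scaleC_scaleC scaleC_one
    lie_alternating ader.expand)

end

lemma lie_bracket_inA_inA: "\<lbrakk>inA f, inA g\<rbrakk>\<^sub>L = 0"
  by (simp add: ader_defs zero_der.rep_eq lie_alternating)

lemma lie_bracket_inDer_inDer: "\<lbrakk>inDer d, inDer e\<rbrakk>\<^sub>L = inDer \<lbrakk>d, e\<rbrakk>\<^sub>L"
proof -
  have "der_apply d 0 = 0" for d :: "'a der"
    using derivation_diff_eq[OF derivation_der_apply, of d 0 0] by simp
  then show ?thesis by (simp add: ader_defs)
qed

lemma lie_bracket_inDer_inA: "\<lbrakk>inDer (D u r), inA (tpow s)\<rbrakk>\<^sub>L = dot u s *\<^sub>C inA (tpow (r + s))"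
proof -
  have "\<lbrakk>d, 0\<rbrakk>\<^sub>L = 0" for d :: "'a der"
    using lie_scaleC_right[of d 0 0] by simp
  then show ?thesis by (simp add: ader_defs D_tpow zero_der.rep_eq)
qed

section \<open>Tensor products over the complex numbers\<close>

text \<open>The quotient of the free vector space on \<open>'a \<times> 'b\<close> by the bilinearity relations.\<close>

abbreviation free_gen :: "'a \<times> 'b \<Rightarrow> ('a \<times> 'b) \<Rightarrow>\<^sub>0 complex"
  where "free_gen p \<equiv> Poly_Mapping.single p 1"

definition tensor_relations ::
    "(('a::complex_vector \<times> 'b::complex_vector) \<Rightarrow>\<^sub>0 complex) set"
  where "tensor_relations =
      {free_gen (x + x', y) - free_gen (x, y) - free_gen (x', y) | x x' y. True}
    \<union> {free_gen (x, y + y') - free_gen (x, y) - free_gen (x, y') | x y y'. True}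
    \<union> {free_gen (c *\<^sub>C x, y) - c *\<^sub>C free_gen (x, y) | c x y. True}
    \<union> {free_gen (x, c *\<^sub>C y) - c *\<^sub>C free_gen (x, y) | c x y. True}"

definition tensor_eq ::
    "(('a::complex_vector \<times> 'b::complex_vector) \<Rightarrow>\<^sub>0 complex) \<Rightarrow> (('a \<times> 'b) \<Rightarrow>\<^sub>0 complex) \<Rightarrow> bool"
  where "tensor_eq f g \<longleftrightarrow> f - g \<in> complex_vector.span tensor_relations"

lemma equivp_tensor_eq:
  "equivp (tensor_eq :: (('a::complex_vector \<times> 'b::complex_vector) \<Rightarrow>\<^sub>0 complex) \<Rightarrow> _)"
proof (rule equivpI)
  show "reflp (tensor_eq :: (('a \<times> 'b) \<Rightarrow>\<^sub>0 complex) \<Rightarrow> _)"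
    by (simp add: reflp_def tensor_eq_def complex_vector.span_zero)
  show "symp (tensor_eq :: (('a \<times> 'b) \<Rightarrow>\<^sub>0 complex) \<Rightarrow> _)"
    unfolding symp_def tensor_eq_def by (metis complex_vector.span_neg minus_diff_eq)
  show "transp (tensor_eq :: (('a \<times> 'b) \<Rightarrow>\<^sub>0 complex) \<Rightarrow> _)"
    unfolding transp_def tensor_eq_def
  proof (intro allI impI)
    fix f g h :: "('a \<times> 'b) \<Rightarrow>\<^sub>0 complex"
    assume "f - g \<in> complex_vector.span tensor_relations"
      "g - h \<in> complex_vector.span tensor_relations"
    then have "(f - g) + (g - h) \<in> complex_vector.span tensor_relations"
      by (rule complex_vector.span_add)
    then show "f - h \<in> complex_vector.span tensor_relations" by simp
  qed
qed

quotient_type (overloaded) ('a, 'b) tensor =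
  "('a::complex_vector \<times> 'b::complex_vector) \<Rightarrow>\<^sub>0 complex" / tensor_eq
  by (rule equivp_tensor_eq)

instantiation tensor :: (complex_vector, complex_vector) complex_vector
begin

lift_definition zero_tensor :: "('a, 'b) tensor" is 0 .
lift_definition plus_tensor :: "('a, 'b) tensor \<Rightarrow> ('a, 'b) tensor \<Rightarrow> ('a, 'b) tensor" is "(+)"
  unfolding tensor_eq_def by (drule (1) complex_vector.span_add) (simp add: algebra_simps)
lift_definition uminus_tensor :: "('a, 'b) tensor \<Rightarrow> ('a, 'b) tensor" is uminus
  unfolding tensor_eq_def by (drule complex_vector.span_neg) simp
lift_definition minus_tensor :: "('a, 'b) tensor \<Rightarrow> ('a, 'b) tensor \<Rightarrow> ('a, 'b) tensor" is "(-)"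
  unfolding tensor_eq_def by (drule (1) complex_vector.span_diff) (simp add: algebra_simps)
lift_definition scaleC_tensor :: "complex \<Rightarrow> ('a, 'b) tensor \<Rightarrow> ('a, 'b) tensor" is "(*\<^sub>C)"
  unfolding tensor_eq_def
  by (simp add: complex_vector.span_scale flip: complex_vector.scale_right_diff_distrib)

instance
proof -
  have eqI: "tensor_eq f g" if "f = g" for f g :: "('a \<times> 'b) \<Rightarrow>\<^sub>0 complex"
    using that equivp_reflp[OF equivp_tensor_eq] by simp
  show "OFCLASS(('a, 'b) tensor, complex_vector_class)"
    by standard (transfer, rule eqI,
        simp add: scaleC_add_right scaleC_add_left scaleC_scaleC scaleC_one add.assoc add.commute)+
qed

end

lift_definition tens :: "'a::complex_vector \<Rightarrow> 'b::complex_vector \<Rightarrow> ('a, 'b) tensor"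
    (infixl \<open>\<otimes>\<close> 76)
  is "\<lambda>x y. free_gen (x, y)" .

lemma cbilinear_tens: "cbilinear (\<otimes>)"
proof -
  have eqI: "tensor_eq f g" if "f - g \<in> tensor_relations" for f g :: "('a \<times> 'b) \<Rightarrow>\<^sub>0 complex"
    using that by (simp add: tensor_eq_def complex_vector.span_base)
  have "x \<otimes> (y + y') = x \<otimes> y + x \<otimes> y'" for x :: 'a and y y' :: 'b
    by transfer (rule eqI, unfold tensor_relations_def diff_diff_eq[symmetric], blast)
  moreover have "(x + x') \<otimes> y = x \<otimes> y + x' \<otimes> y" for x x' :: 'a and y :: 'b
    by transfer (rule eqI, unfold tensor_relations_def diff_diff_eq[symmetric], blast)
  moreover have "x \<otimes> (c *\<^sub>C y) = c *\<^sub>C (x \<otimes> y)" for c and x :: 'a and y :: 'b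
    by transfer (rule eqI, unfold tensor_relations_def, blast)
  moreover have "(c *\<^sub>C x) \<otimes> y = c *\<^sub>C (x \<otimes> y)" for c and x :: 'a and y :: 'b
    by transfer (rule eqI, unfold tensor_relations_def, blast)
  ultimately show ?thesis by (simp add: cbilinear_def clinear_iff)
qed

lemma tensor_induct [case_names zero tens add]:
  assumes "P 0" "\<And>x y. P (x \<otimes> y)" "\<And>s t. P s \<Longrightarrow> P t \<Longrightarrow> P (s + t)"
  shows "P (t :: ('a::complex_vector, 'b::complex_vector) tensor)"
proof -
  have "P (abs_tensor f)" for f
  proof (induction f rule: poly_mapping_add_induct)
    case zero
    then show ?case using assms(1) by (simp add: zero_tensor_def)
  next
    case (single k c)
    obtain x y where k: "k = (x, y)" by (cases k)
    have "abs_tensor (Poly_Mapping.single k c) = abs_tensor (c *\<^sub>C free_gen (x, y))"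
      by (simp add: k scaleC_single scaleC_complex_def)
    also have "\<dots> = c *\<^sub>C (x \<otimes> y)"
      by (simp add: tens.abs_eq scaleC_tensor.abs_eq)
    also have "\<dots> = (c *\<^sub>C x) \<otimes> y"
      using cbilinear_tens unfolding cbilinear_def clinear_iff by metis
    finally show ?case using assms(2) by simp
  next
    case (add f g)
    then show ?case using assms(3) by (metis plus_tensor.abs_eq)
  qed
  then show ?thesis by (metis Quotient3_abs_rep Quotient3_tensor)
qed

definition free_lift :: "('a \<Rightarrow> 'b \<Rightarrow> 'c::complex_vector) \<Rightarrow> (('a \<times> 'b) \<Rightarrow>\<^sub>0 complex) \<Rightarrow> 'c"
  where "free_lift h f =
    (\<Sum>p\<in>Poly_Mapping.keys f. Poly_Mapping.lookup f p *\<^sub>C h (fst p) (snd p))"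

lemma free_lift_superset:
  assumes "finite K" "Poly_Mapping.keys f \<subseteq> K"
  shows "free_lift h f = (\<Sum>p\<in>K. Poly_Mapping.lookup f p *\<^sub>C h (fst p) (snd p))"
  unfolding free_lift_def using assms
  by (intro sum.mono_neutral_left) (auto simp: in_keys_iff)

lemma clinear_free_lift: "clinear (free_lift h)"
proof -
  have "free_lift h (f + g) = free_lift h f + free_lift h g" for f g
  proof -
    let ?K = "Poly_Mapping.keys f \<union> Poly_Mapping.keys g"
    have "Poly_Mapping.keys (f + g) \<subseteq> ?K" by (rule keys_add)
    then show ?thesis
      by (simp add: free_lift_superset[of ?K] lookup_add scaleC_add_left sum.distrib)
  qed
  moreover have "free_lift h (c *\<^sub>C f) = c *\<^sub>C free_lift h f" for c f
  proof -
    have "Poly_Mapping.keys (c *\<^sub>C f) \<subseteq> Poly_Mapping.keys f"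
      by (auto simp: in_keys_iff lookup_scaleC scaleC_complex_def)
    then show ?thesis
      by (simp add: free_lift_superset[of "Poly_Mapping.keys f"] lookup_scaleC scaleC_complex_def
          scaleC_scaleC complex_vector.scale_sum_right)
  qed
  ultimately show ?thesis by (simp add: clinear_iff)
qed

lemma free_lift_gen: "free_lift h (free_gen (x, y)) = h x y"
  by (simp add: free_lift_def scaleC_one)

lemma clinear_diff: "clinear f \<Longrightarrow> f (x - y) = f x - f y"
  by (metis add_diff_cancel_right' clinear_iff diff_add_cancel)

lemma free_lift_cong:
  assumes h: "cbilinear h" and "tensor_eq f g"
  shows "free_lift h f = free_lift h g"
proof -
  note lin = clinear_free_lift[of h]
  note add = lin[unfolded clinear_iff, THEN conjunct1, rule_format]
  note scale = lin[unfolded clinear_iff, THEN conjunct2, rule_format]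
  have "free_lift h r = 0" if "r \<in> complex_vector.span tensor_relations" for r
    using that
  proof (induction rule: complex_vector.span_induct_alt)
    case base
    show ?case using scale[of 0 0] by simp
  next
    case (step c r s)
    have "free_lift h r = 0"
      using step(1) h
      by (auto simp: tensor_relations_def clinear_diff[OF lin] scale free_lift_gen
          cbilinear_def clinear_iff)
    with step(2) show ?case by (simp add: add scale)
  qed
  with assms(2) have "free_lift h (f - g) = 0" by (simp add: tensor_eq_def)
  then show ?thesis by (simp add: clinear_diff[OF lin])
qed

definition tensor_lift ::
    "('a::complex_vector \<Rightarrow> 'b::complex_vector \<Rightarrow> 'c::complex_vector) \<Rightarrow> ('a, 'b) tensor \<Rightarrow> 'c"
  where "tensor_lift h t = free_lift h (rep_tensor t)"

lemma tensor_lift_abs: "cbilinear h \<Longrightarrow> tensor_lift h (abs_tensor f) = free_lift h f"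
  unfolding tensor_lift_def
  by (rule free_lift_cong) (simp_all add: Quotient3_rep_abs[OF Quotient3_tensor] equivp_reflp[OF equivp_tensor_eq])

lemma tensor_lift_tens: "cbilinear h \<Longrightarrow> tensor_lift h (x \<otimes> y) = h x y"
  by (simp add: tens.abs_eq tensor_lift_abs free_lift_gen)

lemma clinear_tensor_lift:
  assumes "cbilinear h" shows "clinear (tensor_lift h)"
proof -
  have abs: "\<exists>f. t = abs_tensor f" for t :: "('a, 'b) tensor"
    by (metis Quotient3_abs_rep Quotient3_tensor)
  have "tensor_lift h (s + t) = tensor_lift h s + tensor_lift h t" for s t
    using abs[of s] abs[of t] clinear_free_lift[of h]
    by (auto simp: plus_tensor.abs_eq tensor_lift_abs[OF assms] clinear_iff)
  moreover have "tensor_lift h (c *\<^sub>C t) = c *\<^sub>C tensor_lift h t" for c t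
    using abs[of t] clinear_free_lift[of h]
    by (auto simp: scaleC_tensor.abs_eq tensor_lift_abs[OF assms] clinear_iff)
  ultimately show ?thesis by (simp add: clinear_iff)
qed

section \<open>The Lie algebra \<open>L \<otimes> B\<close>\<close>

lemma scaleC_mult_right: "x * (c *\<^sub>C y) = c *\<^sub>C (x * y)" for x :: "'a::complex_comm_algebra"
  by (metis mult.commute scaleC_mult_left)

lemma tens_simps:
  "x \<otimes> (y + y') = x \<otimes> y + x \<otimes> y'" "(x + x') \<otimes> y = x \<otimes> y + x' \<otimes> y"
  "x \<otimes> (c *\<^sub>C y) = c *\<^sub>C (x \<otimes> y)" "(c *\<^sub>C x) \<otimes> y = c *\<^sub>C (x \<otimes> y)"
  using cbilinear_tens unfolding cbilinear_def clinear_iff by blast+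

instantiation tensor :: (complex_lie_algebra, complex_comm_algebra) complex_lie_algebra
begin

text \<open>The bilinear extension of \<open>\<lbrakk>X \<otimes> b, Y \<otimes> b'\<rbrakk> = \<lbrakk>X, Y\<rbrakk> \<otimes> bb'\<close>, see \<open>lie_bracket_tens\<close>.\<close>

definition lie_bracket_tensor :: "('a, 'b) tensor \<Rightarrow> ('a, 'b) tensor \<Rightarrow> ('a, 'b) tensor"
  where "\<lbrakk>s, t\<rbrakk>\<^sub>L =
    tensor_lift (\<lambda>X b. tensor_lift (\<lambda>Y b'. \<lbrakk>X, Y\<rbrakk>\<^sub>L \<otimes> (b * b')) t) s"

context
begin

private lemma inner: "cbilinear (\<lambda>Y b'. \<lbrakk>X, Y\<rbrakk>\<^sub>L \<otimes> (b * b'))" for X :: 'a and b :: 'b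
  by (simp add: cbilinear_def clinear_iff tens_simps lie_add_right lie_scaleC_right
      distrib_left scaleC_mult_right)

private lemmas inner_lin = clinear_tensor_lift[OF inner, unfolded clinear_iff]

private lemma outer:
  "cbilinear (\<lambda>(X::'a) (b::'b). tensor_lift (\<lambda>Y b'. \<lbrakk>X, Y\<rbrakk>\<^sub>L \<otimes> (b * b')) t)"
proof -
  define k where "k = (\<lambda>(X::'a) (b::'b). tensor_lift (\<lambda>Y b'. \<lbrakk>X, Y\<rbrakk>\<^sub>L \<otimes> (b * b')))"
  have add: "k X b (s + t) = k X b s + k X b t" and scale: "k X b (c *\<^sub>C t) = c *\<^sub>C k X b t"
    and tens: "k X b (Y \<otimes> b') = \<lbrakk>X, Y\<rbrakk>\<^sub>L \<otimes> (b * b')" for X b s t c Y b'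
    by (simp_all add: k_def inner_lin tensor_lift_tens[OF inner])
  have zero: "k X b 0 = 0" for X b
    using scale[of X b 0 0] by simp
  have "cbilinear (\<lambda>X b. k X b t)"
    unfolding cbilinear_def clinear_iff
    by (induction t rule: tensor_induct)
      (simp_all add: zero add tens tens_simps lie_add_left lie_scaleC_left
        scaleC_mult_left scaleC_mult_right scaleC_add_right algebra_simps)
  then show ?thesis by (simp add: k_def)
qed

private lemmas outer_lin = clinear_tensor_lift[OF outer, unfolded clinear_iff]

lemma lie_bracket_tens: "\<lbrakk>X \<otimes> b, Y \<otimes> b'\<rbrakk>\<^sub>L = \<lbrakk>X, Y\<rbrakk>\<^sub>L \<otimes> (b * b')" for X Y :: 'a and b b' :: 'b
  by (simp only: lie_bracket_tensor_def tensor_lift_tens[OF outer])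
    (simp only: tensor_lift_tens[OF inner])

private lemma left: "\<lbrakk>s + s', t\<rbrakk>\<^sub>L = \<lbrakk>s, t\<rbrakk>\<^sub>L + \<lbrakk>s', t\<rbrakk>\<^sub>L" "\<lbrakk>c *\<^sub>C s, t\<rbrakk>\<^sub>L = c *\<^sub>C \<lbrakk>s, t\<rbrakk>\<^sub>L"
  for s s' t :: "('a, 'b) tensor"
  by (simp_all add: lie_bracket_tensor_def outer_lin)

private lemma left0: "\<lbrakk>0, t\<rbrakk>\<^sub>L = 0" for t :: "('a, 'b) tensor"
  using left(2)[of 0 0 t] by simp

private lemma right:
  "\<lbrakk>s, t + t'\<rbrakk>\<^sub>L = \<lbrakk>s, t\<rbrakk>\<^sub>L + \<lbrakk>s, t'\<rbrakk>\<^sub>L" "\<lbrakk>s, c *\<^sub>C t\<rbrakk>\<^sub>L = c *\<^sub>C \<lbrakk>s, t\<rbrakk>\<^sub>L"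
  for s t t' :: "('a, 'b) tensor"
proof -
  have "\<lbrakk>X \<otimes> b, t + t'\<rbrakk>\<^sub>L = \<lbrakk>X \<otimes> b, t\<rbrakk>\<^sub>L + \<lbrakk>X \<otimes> b, t'\<rbrakk>\<^sub>L"
    "\<lbrakk>X \<otimes> b, c *\<^sub>C t\<rbrakk>\<^sub>L = c *\<^sub>C \<lbrakk>X \<otimes> b, t\<rbrakk>\<^sub>L" for X :: 'a and b :: 'b
    by (simp_all only: lie_bracket_tensor_def tensor_lift_tens[OF outer])
      (simp_all only: inner_lin)
  then have "\<lbrakk>s, t + t'\<rbrakk>\<^sub>L = \<lbrakk>s, t\<rbrakk>\<^sub>L + \<lbrakk>s, t'\<rbrakk>\<^sub>L \<and> \<lbrakk>s, c *\<^sub>C t\<rbrakk>\<^sub>L = c *\<^sub>C \<lbrakk>s, t\<rbrakk>\<^sub>L"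
    by (induction s rule: tensor_induct) (simp_all add: left left0 scaleC_add_right algebra_simps)
  then show "\<lbrakk>s, t + t'\<rbrakk>\<^sub>L = \<lbrakk>s, t\<rbrakk>\<^sub>L + \<lbrakk>s, t'\<rbrakk>\<^sub>L" "\<lbrakk>s, c *\<^sub>C t\<rbrakk>\<^sub>L = c *\<^sub>C \<lbrakk>s, t\<rbrakk>\<^sub>L"
    by blast+
qed

private lemma right0: "\<lbrakk>t, 0\<rbrakk>\<^sub>L = 0" for t :: "('a, 'b) tensor"
  using right(2)[of t 0 0] by simp

private lemma tens_neg: "(- x) \<otimes> y = - (x \<otimes> y)" for x :: 'a and y :: 'b
  using tens_simps(4)[of "-1" x y] by simp

private lemma tens_zero: "0 \<otimes> y = (0 :: ('a, 'b) tensor)"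
  using tens_simps(4)[of 0 0 y] by simp

private lemma anti: "\<lbrakk>s, t\<rbrakk>\<^sub>L = - \<lbrakk>t, s\<rbrakk>\<^sub>L" for s t :: "('a, 'b) tensor"
proof (induction s rule: tensor_induct)
  case (tens X b)
  show ?case
  proof (induction t rule: tensor_induct)
    case (tens Y b')
    show ?case
      by (simp add: lie_bracket_tens mult.commute[of b b'] lie_antisym[of X Y] flip: tens_neg)
  qed (simp_all add: left right left0 right0)
qed (simp_all add: left right left0 right0)

private lemma jacobi:
  "\<lbrakk>x, \<lbrakk>y, z\<rbrakk>\<^sub>L\<rbrakk>\<^sub>L + \<lbrakk>y, \<lbrakk>z, x\<rbrakk>\<^sub>L\<rbrakk>\<^sub>L + \<lbrakk>z, \<lbrakk>x, y\<rbrakk>\<^sub>L\<rbrakk>\<^sub>L = 0" for x y z :: "('a, 'b) tensor"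
proof (induction x rule: tensor_induct)
  case (tens X a)
  show ?case
  proof (induction y rule: tensor_induct)
    case (tens Y b)
    show ?case
    proof (induction z rule: tensor_induct)
      case (tens Z c)
      have "b * (c * a) = a * (b * c)" "c * (a * b) = a * (b * c)"
        by (simp_all add: ac_simps)
      then show ?case
        by (simp only: lie_bracket_tens tens_simps(2)[symmetric] lie_jacobi tens_zero)
    next
      case (add s t)
      have "?case \<longleftrightarrow> (\<lbrakk>X \<otimes> a, \<lbrakk>Y \<otimes> b, s\<rbrakk>\<^sub>L\<rbrakk>\<^sub>L + \<lbrakk>Y \<otimes> b, \<lbrakk>s, X \<otimes> a\<rbrakk>\<^sub>L\<rbrakk>\<^sub>L + \<lbrakk>s, \<lbrakk>X \<otimes> a, Y \<otimes> b\<rbrakk>\<^sub>L\<rbrakk>\<^sub>L)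
        + (\<lbrakk>X \<otimes> a, \<lbrakk>Y \<otimes> b, t\<rbrakk>\<^sub>L\<rbrakk>\<^sub>L + \<lbrakk>Y \<otimes> b, \<lbrakk>t, X \<otimes> a\<rbrakk>\<^sub>L\<rbrakk>\<^sub>L + \<lbrakk>t, \<lbrakk>X \<otimes> a, Y \<otimes> b\<rbrakk>\<^sub>L\<rbrakk>\<^sub>L) = 0"
        by (simp add: left right algebra_simps)
      with add show ?case by simp
    qed (simp add: left0 right0)
  next
    case (add s t)
    have "?case \<longleftrightarrow> (\<lbrakk>X \<otimes> a, \<lbrakk>s, z\<rbrakk>\<^sub>L\<rbrakk>\<^sub>L + \<lbrakk>s, \<lbrakk>z, X \<otimes> a\<rbrakk>\<^sub>L\<rbrakk>\<^sub>L + \<lbrakk>z, \<lbrakk>X \<otimes> a, s\<rbrakk>\<^sub>L\<rbrakk>\<^sub>L)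
      + (\<lbrakk>X \<otimes> a, \<lbrakk>t, z\<rbrakk>\<^sub>L\<rbrakk>\<^sub>L + \<lbrakk>t, \<lbrakk>z, X \<otimes> a\<rbrakk>\<^sub>L\<rbrakk>\<^sub>L + \<lbrakk>z, \<lbrakk>X \<otimes> a, t\<rbrakk>\<^sub>L\<rbrakk>\<^sub>L) = 0"
      by (simp add: left right algebra_simps)
    with add show ?case by simp
  qed (simp add: left0 right0)
next
  case (add s t)
  have "?case \<longleftrightarrow> (\<lbrakk>s, \<lbrakk>y, z\<rbrakk>\<^sub>L\<rbrakk>\<^sub>L + \<lbrakk>y, \<lbrakk>z, s\<rbrakk>\<^sub>L\<rbrakk>\<^sub>L + \<lbrakk>z, \<lbrakk>s, y\<rbrakk>\<^sub>L\<rbrakk>\<^sub>L)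
    + (\<lbrakk>t, \<lbrakk>y, z\<rbrakk>\<^sub>L\<rbrakk>\<^sub>L + \<lbrakk>y, \<lbrakk>z, t\<rbrakk>\<^sub>L\<rbrakk>\<^sub>L + \<lbrakk>z, \<lbrakk>t, y\<rbrakk>\<^sub>L\<rbrakk>\<^sub>L) = 0"
    by (simp add: left right algebra_simps)
  with add show ?case by simp
qed (simp add: left0 right0)

private lemma alternating: "\<lbrakk>x, x\<rbrakk>\<^sub>L = 0" for x :: "('a, 'b) tensor"
proof (induction x rule: tensor_induct)
  case (tens X b)
  show ?case by (simp add: lie_bracket_tens lie_alternating tens_zero)
next
  case (add s t)
  then show ?case using anti[of s t] by (simp add: left right)
qed (simp add: left0)

instance by standard (fact left right alternating jacobi)+

end

end

section \<open>Modules\<close>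

definition lie_module :: "('l::complex_lie_algebra \<Rightarrow> 'v::complex_vector \<Rightarrow> 'v) \<Rightarrow> bool"
  where "lie_module act \<longleftrightarrow> cbilinear act \<and>
    (\<forall>x y v. act \<lbrakk>x, y\<rbrakk>\<^sub>L v = act x (act y v) - act y (act x v))"

definition lie_submodule :: "('l::complex_lie_algebra \<Rightarrow> 'v::complex_vector \<Rightarrow> 'v) \<Rightarrow> 'v set \<Rightarrow> bool"
  where "lie_submodule act W \<longleftrightarrow> complex_vector.subspace W \<and> (\<forall>x. \<forall>w\<in>W. act x w \<in> W)"

definition irreducible_lie_module :: "('l::complex_lie_algebra \<Rightarrow> 'v::complex_vector \<Rightarrow> 'v) \<Rightarrow> bool"
  where "irreducible_lie_module act \<longleftrightarrow> lie_module act \<and> (UNIV :: 'v set) \<noteq> {0} \<and>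
    (\<forall>W. lie_submodule act W \<longrightarrow> W = {0} \<or> W = UNIV)"

definition finite_dimensional :: "'v::complex_vector set \<Rightarrow> bool"
  where "finite_dimensional W \<longleftrightarrow> (\<exists>S. finite S \<and> complex_vector.span S = W)"

text \<open>\<open>V\<close> is the internal direct sum of the subspaces \<open>W i\<close>, \<open>i \<in> I\<close>.\<close>

definition is_direct_sum :: "'i set \<Rightarrow> ('i \<Rightarrow> 'v::complex_vector set) \<Rightarrow> bool"
  where "is_direct_sum I W \<longleftrightarrow> (\<forall>v. \<exists>!f. (\<forall>i\<in>I. f i \<in> W i) \<and> (\<forall>i. i \<notin> I \<longrightarrow> f i = 0) \<and>
    finite {i. f i \<noteq> 0} \<and> v = (\<Sum>i | f i \<noteq> 0. f i))"

type_synonym ('n, 'b) tau = "('n ader, 'b) tensor"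

definition cartan_der :: "'n::finite ader set"
  where "cartan_der = complex_vector.span {inDer (D u 0) | u. True}"

definition cartan :: "'n::finite ader set"
  where "cartan = {c *\<^sub>C inA (tpow 0) + h | c h. h \<in> cartan_der}"

text \<open>The dual of a subspace \<open>H\<close>; a functional on \<open>H\<close> is represented by its extension by zero,
  so that distinct elements are distinct functionals on \<open>H\<close>.\<close>

definition dual_of :: "'a::complex_vector set \<Rightarrow> ('a \<Rightarrow> complex) set"
  where "dual_of H = {l. (\<forall>x\<in>H. \<forall>y\<in>H. l (x + y) = l x + l y) \<and>
    (\<forall>c. \<forall>x\<in>H. l (c *\<^sub>C x) = c * l x) \<and> (\<forall>x. x \<notin> H \<longrightarrow> l x = 0)}"

definition weight_space ::
    "(('n::finite, 'b::complex_comm_algebra) tau \<Rightarrow> 'v::complex_vector \<Rightarrow> 'v) \<Rightarrow>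
      ('n ader \<Rightarrow> complex) \<Rightarrow> 'v set"
  where "weight_space act l = {v. \<forall>h\<in>cartan. act (h \<otimes> 1) v = l h *\<^sub>C v}"

definition weight_module ::
    "(('n::finite, 'b::complex_comm_algebra) tau \<Rightarrow> 'v::complex_vector \<Rightarrow> 'v) \<Rightarrow> bool"
  where "weight_module act \<longleftrightarrow> is_direct_sum (dual_of cartan) (weight_space act)"

definition associative_action ::
    "(('n::finite, 'b::complex_comm_algebra) tau \<Rightarrow> 'v::complex_vector \<Rightarrow> 'v) \<Rightarrow> bool"
  where "associative_action act \<longleftrightarrow> (\<forall>r s b b' v.
    act (inA (tpow r) \<otimes> b) (act (inA (tpow s) \<otimes> b') v) = act (inA (tpow (r + s)) \<otimes> (b * b')) v)"

end

theory Submission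
  imports Defs "HOL-Library.Function_Algebras"
    "HOL-Computational_Algebra.Fundamental_Theorem_Algebra"
begin

text \<open>By Schur's lemma \<open>t\<^sup>0b\<close> acts as a scalar \<open>\<theta>(b)\<close>, so by associativity \<open>A \<otimes> ker \<theta>\<close> acts by zero,
  and it suffices that \<open>Der A \<otimes> ker \<theta>\<close> acts by zero too. The operators
  \<open>Y(u,r,b) = t\<^sup>-\<^sup>r D(u,r)b\<close> preserve a weight space \<open>W\<close>, which is finite dimensional, and for
  \<open>x \<in> ker \<theta>\<close> they commute with \<open>A\<close> and are determined by their restriction to \<open>W\<close>. Let \<open>K\<close>
  be the set of those \<open>x\<close> for which all \<open>Y(u,r,x)\<close> vanish; it is an ideal of \<open>B\<close>.

  If \<open>x\<^sup>2 \<in> K\<close>, the operators \<open>Y(u,r,bx)\<close> commute. They are sums of eigenvectors for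
  nonzero eigenvalues of inner derivations, hence nilpotent on \<open>W\<close>, and have a common
  kernel vector. The vectors killed by the ideal \<open>(A \<rtimes> Der A) \<otimes> Bx\<close> form a submodule,
  so irreducibility gives \<open>x \<in> K\<close>.

  If \<open>Y(v,r,x) = 0\<close> for a single \<open>r\<close> and a single \<open>v \<noteq> 0\<close>, then \<open>x\<^sup>3 \<in> K\<close> by the bracket
  relations, hence \<open>x \<in> K\<close>. So for \<open>m \<in> ker \<theta>\<close> outside \<open>K\<close>, an eigenvector of \<open>ad Y(v,0,m)\<close> on
  the space of all \<open>Y(v,r,bm)\<close> yields \<open>e \<in> Bm\<close> outside \<open>K\<close> with \<open>me - \<alpha>e \<in> K\<close>. Here \<open>\<alpha> \<noteq> 0\<close>, since
  otherwise \<open>e\<^sup>2 \<in> K\<close>. As \<open>[Y(v,0,m), Y(v,r,e)] = (v,r)\<alpha> Y(v,r,e)\<close>, the derivation \<open>ad Y(v,0,m)\<close> has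
  infinitely many eigenvalues on \<open>End W\<close>, a contradiction.\<close>

section \<open>Operators on finite-dimensional complex vector spaces\<close>

text \<open>Operators thereby become vectors, so that the eigenvector lemmas apply to commutators
  acting on spaces of operators.\<close>

instantiation "fun" :: (type, complex_vector) complex_vector
begin

definition scaleC_fun :: "complex \<Rightarrow> ('a \<Rightarrow> 'b) \<Rightarrow> 'a \<Rightarrow> 'b"
  where "scaleC_fun c f = (\<lambda>x. c *\<^sub>C f x)"

instance
  by standard (simp_all add: fun_eq_iff scaleC_fun_def scaleC_add_right scaleC_add_left
    scaleC_scaleC scaleC_one)

end

lemma clinearD:
  assumes "clinear f"
  shows "f (x + y) = f x + f y" "f (c *\<^sub>C x) = c *\<^sub>C f x" "f 0 = 0" "f (- x) = - f x"
    "f (x - y) = f x - f y" "f (sum g I) = (\<Sum>i\<in>I. f (g i))"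
proof -
  interpret Vector_Spaces.linear scaleC scaleC f by fact
  show "f (x + y) = f x + f y" "f (c *\<^sub>C x) = c *\<^sub>C f x" "f 0 = 0" "f (- x) = - f x"
    "f (x - y) = f x - f y" "f (sum g I) = (\<Sum>i\<in>I. f (g i))"
    by (fact add scale zero neg diff sum)+
qed

lemma independent_finite:
  assumes "finite B" "S \<subseteq> complex_vector.span B" "complex_vector.independent S"
  shows "finite S"
  using complex_vector.independent_span_bound assms by blast

section \<open>Polynomials in an operator and eigenvectors\<close>

definition poly_op :: "('a::complex_vector \<Rightarrow> 'a) \<Rightarrow> complex poly \<Rightarrow> 'a \<Rightarrow> 'a"
  where "poly_op T p x = (\<Sum>k\<le>degree p. coeff p k *\<^sub>C (T ^^ k) x)"

lemma poly_op_superset: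
  assumes "degree p \<le> N" shows "poly_op T p x = (\<Sum>k\<le>N. coeff p k *\<^sub>C (T ^^ k) x)"
  unfolding poly_op_def using assms
  by (intro sum.mono_neutral_left) (auto simp: coeff_eq_0)

lemma poly_op_add: "poly_op T (p + q) x = poly_op T p x + poly_op T q x"
proof -
  let ?N = "max (degree p) (degree q)"
  show ?thesis
    by (subst (1 2 3) poly_op_superset[of _ ?N])
      (auto simp: degree_add_le_max scaleC_add_left sum.distrib)
qed

lemma poly_op_smult: "poly_op T (smult c p) x = c *\<^sub>C poly_op T p x"
  by (subst poly_op_superset[of _ "degree p"])
    (auto simp: poly_op_def complex_vector.scale_sum_right scaleC_scaleC)

lemma poly_op_sum: "poly_op T (sum f I) x = (\<Sum>i\<in>I. poly_op T (f i) x)"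
  by (induction I rule: infinite_finite_induct) (simp_all add: poly_op_add, simp_all add: poly_op_def)

lemma poly_op_monom: "poly_op T (monom c k) x = c *\<^sub>C (T ^^ k) x"
proof -
  have "poly_op T (monom c k) x = (\<Sum>i\<le>k. coeff (monom c k) i *\<^sub>C (T ^^ i) x)"
    by (rule poly_op_superset) (rule degree_monom_le)
  also have "\<dots> = (\<Sum>i\<in>{k}. coeff (monom c k) i *\<^sub>C (T ^^ i) x)"
    by (rule sum.mono_neutral_right) auto
  finally show ?thesis by simp
qed

lemma poly_op_pCons:
  assumes "clinear T" shows "poly_op T (pCons a p) x = a *\<^sub>C x + T (poly_op T p x)"
proof -
  have "poly_op T (pCons a p) x = (\<Sum>k\<le>Suc (degree p). coeff (pCons a p) k *\<^sub>C (T ^^ k) x)"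
    by (rule poly_op_superset) (simp add: degree_pCons_le)
  then show ?thesis
    by (simp only: sum.atMost_Suc_shift) (simp add: poly_op_def clinearD[OF assms])
qed

lemma poly_op_in:
  assumes "complex_vector.subspace S" "\<And>x. x \<in> S \<Longrightarrow> T x \<in> S" "x \<in> S"
  shows "poly_op T p x \<in> S"
proof -
  have "(T ^^ k) x \<in> S" for k by (induction k) (auto simp: assms)
  then show ?thesis
    unfolding poly_op_def by (intro complex_vector.subspace_sum complex_vector.subspace_scale assms)
qed

text \<open>The iterates of \<open>x\<close> lie in a finite-dimensional space and so satisfy a
  linear relation. Dependence is a property of sets, so coinciding iterates are treated separately,
  by a difference of two monomials.\<close>

lemma exists_annihilating_poly:
  assumes "finite B" "\<And>k. (T ^^ k) x \<in> complex_vector.span B"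
  shows "\<exists>p. p \<noteq> 0 \<and> poly_op T p x = 0"
proof (cases "inj (\<lambda>k. (T ^^ k) x)")
  case True
  then have "infinite (range (\<lambda>k. (T ^^ k) x))"
    by (simp add: finite_image_iff)
  moreover have "range (\<lambda>k. (T ^^ k) x) \<subseteq> complex_vector.span B" using assms(2) by auto
  ultimately have "complex_vector.dependent (range (\<lambda>k. (T ^^ k) x))"
    using independent_finite[OF assms(1)] by metis
  then obtain t u where t: "finite t" "t \<subseteq> range (\<lambda>k. (T ^^ k) x)" "(\<Sum>v\<in>t. u v *\<^sub>C v) = 0"
    and u: "\<exists>v\<in>t. u v \<noteq> 0"
    unfolding complex_vector.dependent_explicit by blast
  obtain I where I: "t = (\<lambda>k. (T ^^ k) x) ` I" using t(2) by (meson subset_image_iff)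
  have inj: "inj_on (\<lambda>k. (T ^^ k) x) I" using True by (rule inj_on_subset) simp
  have "finite I" using t(1) inj unfolding I by (rule finite_imageD)
  define p where "p = (\<Sum>k\<in>I. monom (u ((T ^^ k) x)) k)"
  have "poly_op T p x = 0"
    using t(3) by (simp add: p_def poly_op_sum poly_op_monom I sum.reindex[OF inj])
  moreover have "p \<noteq> 0"
  proof -
    obtain k where k: "k \<in> I" "u ((T ^^ k) x) \<noteq> 0" using u I by blast
    have "coeff p k = u ((T ^^ k) x)"
      using \<open>finite I\<close> k(1) by (simp add: p_def coeff_sum)
    with k show ?thesis by auto
  qed
  ultimately show ?thesis by blast
next
  case False
  then obtain i j where ij: "i \<noteq> j" "(T ^^ i) x = (T ^^ j) x" by (auto simp: inj_on_def)
  have "poly_op T (monom 1 i + monom (-1) j) x = 0"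
    using ij by (simp add: poly_op_add poly_op_monom scaleC_one)
  moreover have "monom 1 i + monom (-1) j \<noteq> (0 :: complex poly)"
  proof
    assume "monom 1 i + monom (-1) j = (0 :: complex poly)"
    then have "coeff (monom 1 i + monom (-1) j :: complex poly) i = 0" by simp
    with ij(1) show False by simp
  qed
  ultimately show ?thesis by blast
qed

text \<open>Induction on the degree of an annihilating polynomial \<open>p = (X - a) q\<close>:
  either \<open>q(T) x\<close> is an eigenvector for \<open>a\<close>, or \<open>q\<close>
  annihilates \<open>x\<close> as well.\<close>

lemma exists_eigenvector:
  assumes T: "clinear T" and S: "complex_vector.subspace S" "\<And>x. x \<in> S \<Longrightarrow> T x \<in> S"
    and fin: "finite B" "S \<subseteq> complex_vector.span B" and x: "x \<in> S" "x \<noteq> 0"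
  shows "\<exists>y\<in>S. \<exists>c. y \<noteq> 0 \<and> T y = c *\<^sub>C y"
proof -
  have "(T ^^ k) x \<in> S" for k by (induction k) (auto simp: assms)
  with fin obtain p where "p \<noteq> 0" "poly_op T p x = 0"
    using exists_annihilating_poly[of B T x] by blast
  then show ?thesis
  proof (induction "degree p" arbitrary: p)
    case 0
    then obtain a where "p = [:a:]" "a \<noteq> 0" by (metis degree_eq_zeroE pCons_0_0)
    with 0 x show ?case by (simp add: poly_op_def)
  next
    case (Suc d)
    then have "\<not> constant (poly p)" by (simp add: constant_degree)
    then obtain a where "poly p a = 0" using fundamental_theorem_of_algebra by blast
    then obtain q where q: "p = [:- a, 1:] * q" by (metis dvdE poly_eq_0_iff_dvd)
    with Suc have q0: "q \<noteq> 0" by auto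
    then have "degree p = Suc (degree q)" unfolding q by (subst degree_mult_eq) auto
    then have d: "d = degree q" using Suc by simp
    let ?y = "poly_op T q x"
    have "poly_op T p x = T ?y - a *\<^sub>C ?y"
    proof -
      have "p = smult (- a) q + pCons 0 q" by (simp add: q)
      then show ?thesis by (simp only: poly_op_add poly_op_smult poly_op_pCons[OF T]) simp
    qed
    then have "T ?y = a *\<^sub>C ?y" using Suc by simp
    with Suc(1)[OF d q0] poly_op_in[of S T x q] S x show ?case by blast
  qed
qed

text \<open>Applying \<open>T - \<beta> a\<close> to a relation removes the term at \<open>a\<close>
  and multiplies the others by nonzero factors.\<close>

lemma eigenvectors_independent:
  assumes T: "clinear T" and eig: "\<And>k. T (g k) = \<beta> k *\<^sub>C g k" "\<And>k. g k \<noteq> 0"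
    and "inj \<beta>" "finite F" "(\<Sum>k\<in>F. c k *\<^sub>C g k) = 0"
  shows "\<forall>k\<in>F. c k = 0"
  using assms(5,6)
proof (induction F arbitrary: c)
  case (insert a F)
  have "0 = T (\<Sum>k\<in>insert a F. c k *\<^sub>C g k) - \<beta> a *\<^sub>C (\<Sum>k\<in>insert a F. c k *\<^sub>C g k)"
    using insert(4) by (simp add: clinearD(3)[OF T])
  also have "\<dots> = (\<Sum>k\<in>insert a F. (c k * (\<beta> k - \<beta> a)) *\<^sub>C g k)"
    by (simp only: clinearD[OF T] complex_vector.scale_sum_right sum_subtractf[symmetric] eig)
      (simp add: scaleC_scaleC algebra_simps flip: complex_vector.scale_left_diff_distrib)
  also have "\<dots> = (\<Sum>k\<in>F. (c k * (\<beta> k - \<beta> a)) *\<^sub>C g k)"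
    using insert(1,2) by simp
  finally have "\<forall>k\<in>F. c k * (\<beta> k - \<beta> a) = 0"
    by (intro insert(3)) simp
  then have F: "\<forall>k\<in>F. c k = 0"
    using \<open>inj \<beta>\<close> insert(2) by (auto dest: injD)
  then have "c a *\<^sub>C g a = 0" using insert(1,2,4) by simp
  with F eig(2)[of a] show ?case by simp
qed simp

text \<open>Otherwise the \<open>g k\<close> would be infinitely many independent vectors in a
  finite-dimensional space.\<close>

lemma exists_zero_of_distinct_eigenvalues:
  fixes g :: "nat \<Rightarrow> 'a::complex_vector"
  assumes T: "clinear T" and eig: "\<And>k. T (g k) = \<beta> k *\<^sub>C g k"
    and "inj \<beta>" and fin: "finite B" "\<And>k. g k \<in> complex_vector.span B"
  shows "\<exists>k. g k = 0"
proof (rule ccontr)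
  assume "\<nexists>k. g k = 0"
  then have nz: "g k \<noteq> 0" for k by blast
  note ind = eigenvectors_independent[of T g \<beta>, OF T eig nz \<open>inj \<beta>\<close>]
  have "inj g"
  proof (rule injI)
    fix i j assume ij: "g i = g j"
    then have "(\<beta> i - \<beta> j) *\<^sub>C g i = 0" using eig[of i] eig[of j]
      by (metis complex_vector.scale_left_diff_distrib diff_self)
    then have "\<beta> i = \<beta> j" using nz[of i] by simp
    then show "i = j" using \<open>inj \<beta>\<close> by (simp add: injD)
  qed
  have "complex_vector.independent (range g)"
  proof
    assume "complex_vector.dependent (range g)"
    then obtain t u v where t: "finite t" "t \<subseteq> range g" "(\<Sum>v\<in>t. u v *\<^sub>C v) = 0"
      "v \<in> t" "u v \<noteq> 0" unfolding complex_vector.dependent_explicit by blast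
    obtain I where I: "t = g ` I" using t(2) by (meson subset_image_iff)
    have inj: "inj_on g I" using \<open>inj g\<close> by (rule inj_on_subset) simp
    have "finite I" using t(1) inj unfolding I by (rule finite_imageD)
    from ind[OF this, of "\<lambda>i. u (g i)"] t I inj \<open>inj g\<close>
    show False by (auto simp: sum.reindex)
  qed
  then have "finite (range g)" by (rule independent_finite[OF fin(1), rotated]) (use fin(2) in auto)
  with \<open>inj g\<close> show False by (simp add: finite_image_iff)
qed

text \<open>Induction on the dimension: if some \<open>f\<close> in \<open>F\<close> is nonzero on
  \<open>W\<close>, its kernel in \<open>W\<close> is proper, nonzero by nilpotency, and stable
  under \<open>F\<close> by commutativity.\<close>

lemma common_kernel:
  assumes "complex_vector.subspace W" "W \<subseteq> complex_vector.span B" "finite B" "W \<noteq> {0}"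
    and lin: "\<And>f. f \<in> F \<Longrightarrow> clinear f" and pres: "\<And>f w. f \<in> F \<Longrightarrow> w \<in> W \<Longrightarrow> f w \<in> W"
    and comm: "\<And>f g w. f \<in> F \<Longrightarrow> g \<in> F \<Longrightarrow> w \<in> W \<Longrightarrow> f (g w) = g (f w)"
    and nil: "\<And>f. f \<in> F \<Longrightarrow> \<exists>k. \<forall>w\<in>W. (f ^^ k) w = 0"
  shows "\<exists>w\<in>W. w \<noteq> 0 \<and> (\<forall>f\<in>F. f w = 0)"
  using assms
proof (induction "complex_vector.dim W" arbitrary: W rule: less_induct)
  case less
  show ?case
  proof (cases "\<forall>f\<in>F. \<forall>w\<in>W. f w = 0")
    case True
    with \<open>W \<noteq> {0}\<close> complex_vector.subspace_0[OF less(2)] show ?thesis by blast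
  next
    case False
    then obtain f v where f: "f \<in> F" "v \<in> W" "f v \<noteq> 0" by blast
    define W' where "W' = {w \<in> W. f w = 0}"
    note flin = clinearD[OF less(6)[OF f(1)]]
    have sub: "complex_vector.subspace W'"
      using less(2) by (auto simp: W'_def complex_vector.subspace_def flin)
    have nz: "W' \<noteq> {0}"
    proof -
      from less(9)[OF f(1)] obtain k where k: "\<forall>w\<in>W. (f ^^ k) w = 0" by blast
      \<comment> \<open>With \<open>j\<close> minimal, the last nonzero iterate of \<open>v\<close>
        lies in the kernel.\<close>
      define j where "j = (LEAST k. (f ^^ k) v = 0)"
      have j: "(f ^^ j) v = 0" unfolding j_def by (rule LeastI[of _ k]) (use k f in blast)
      have "j \<noteq> 0" using j f(3) flin(3) by (metis funpow_0)
      then obtain i where i: "j = Suc i" using not0_implies_Suc by blast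
      have "(f ^^ i) v \<noteq> 0"
        using not_less_Least[of i "\<lambda>k. (f ^^ k) v = 0"] i unfolding j_def[symmetric] by auto
      moreover have "(f ^^ i) v \<in> W" by (induction i) (auto simp: f less(7))
      ultimately have "(f ^^ i) v \<in> W'" "(f ^^ i) v \<noteq> 0" using j i by (auto simp: W'_def)
      then show ?thesis by blast
    qed
    \<comment> \<open>Since \<open>f v\<close> is nonzero, adding \<open>v\<close> to a basis of the
      kernel keeps it independent.\<close>
    have dim: "complex_vector.dim W' < complex_vector.dim W"
    proof -
      obtain b where b: "b \<subseteq> W'" "complex_vector.independent b" "W' \<subseteq> complex_vector.span b"
        "card b = complex_vector.dim W'" using complex_vector.basis_exists by blast
      obtain c where c: "c \<subseteq> W" "complex_vector.independent c" "W \<subseteq> complex_vector.span c"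
        "card c = complex_vector.dim W" using complex_vector.basis_exists by blast
      have "finite c"
        by (rule independent_finite[OF less(4) _ c(2)]) (use c(1) less(3) in auto)
      have "complex_vector.span b \<subseteq> W'" using b sub complex_vector.span_minimal by blast
      then have v: "v \<notin> complex_vector.span b" using f(3) by (auto simp: W'_def)
      then have "v \<notin> b" using complex_vector.span_base by blast
      from v b(2) have "complex_vector.independent (insert v b)"
        by (simp add: complex_vector.independent_insert)
      moreover have "insert v b \<subseteq> complex_vector.span c"
        using b(1) c(3) f(2) by (auto simp: W'_def)
      ultimately have "finite (insert v b) \<and> card (insert v b) \<le> card c"
        by (rule complex_vector.independent_span_bound[OF \<open>finite c\<close>])
      with \<open>v \<notin> b\<close> have "card b < card c" by auto
      with b(4) c(4) show ?thesis by simp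
    qed
    have "\<exists>w\<in>W'. w \<noteq> 0 \<and> (\<forall>f\<in>F. f w = 0)"
    proof (rule less(1)[OF dim sub])
      show "finite B" "W' \<noteq> {0}" by fact+
      show "clinear g" if "g \<in> F" for g using less(6)[OF that] .
      show "W' \<subseteq> complex_vector.span B" using less(3) by (auto simp: W'_def)
      show "g w \<in> W'" if g: "g \<in> F" and w: "w \<in> W'" for g w
      proof -
        have "f (g w) = g (f w)" using less(8)[OF f(1) g] w by (auto simp: W'_def)
        then show ?thesis
          using less(7)[OF g] clinearD(3)[OF less(6)[OF g]] w by (auto simp: W'_def)
      qed
      show "\<exists>k. \<forall>w\<in>W'. (g ^^ k) w = 0" if "g \<in> F" for g
        using less(9)[OF that] unfolding W'_def by blast
      show "g (h w) = h (g w)" if "g \<in> F" "h \<in> F" "w \<in> W'" for g h w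
        using less(8)[OF that(1,2)] that(3) unfolding W'_def by blast
    qed
    then show ?thesis by (auto simp: W'_def)
  qed
qed

text \<open>Extension by zero gives a function that depends only on the values on \<open>W\<close>,
  so that End W sits inside the space of functions.\<close>

definition restr :: "'v set \<Rightarrow> ('v \<Rightarrow> 'v) \<Rightarrow> 'v \<Rightarrow> 'v::complex_vector"
  where "restr W f = (\<lambda>x. if x \<in> W then f x else 0)"

lemma restr_finite_dimensional:
  assumes "finite_dimensional W"
  obtains G where "finite G"
    "\<And>f. clinear f \<Longrightarrow> (\<And>w. w \<in> W \<Longrightarrow> f w \<in> W) \<Longrightarrow> restr W f \<in> complex_vector.span G"
proof -
  obtain B where B: "finite B" "complex_vector.span B = W"
    using assms by (auto simp: finite_dimensional_def)
  obtain S where S: "S \<subseteq> W" "complex_vector.independent S" "W \<subseteq> complex_vector.span S"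
    by (rule complex_vector.basis_exists)
  have finS: "finite S"
    by (rule independent_finite[OF B(1) _ S(2)]) (use B(2) S(1) in auto)
  let ?r = "complex_vector.representation S"
  define e where "e s w = restr W (\<lambda>x. ?r x s *\<^sub>C w)" for s w
  have sumr: "(\<Sum>s\<in>S. ?r x s *\<^sub>C s) = x" if "x \<in> W" for x
    using complex_vector.sum_representation_eq[OF S(2) _ finS, of x] that S(3) by blast
  have "restr W f \<in> complex_vector.span ((\<lambda>(s, w). e s w) ` (S \<times> S))"
    if f: "clinear f" "\<And>w. w \<in> W \<Longrightarrow> f w \<in> W" for f
  proof -
    have "restr W f = (\<Sum>s\<in>S. \<Sum>w\<in>S. ?r (f s) w *\<^sub>C e s w)"
    proof
      fix x
      have "(\<Sum>s\<in>S. \<Sum>w\<in>S. ?r (f s) w *\<^sub>C ?r x s *\<^sub>C w) = f x" if "x \<in> W"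
      proof -
        have "(\<Sum>s\<in>S. \<Sum>w\<in>S. ?r (f s) w *\<^sub>C ?r x s *\<^sub>C w)
          = (\<Sum>s\<in>S. ?r x s *\<^sub>C (\<Sum>w\<in>S. ?r (f s) w *\<^sub>C w))"
          by (simp add: complex_vector.scale_sum_right scaleC_scaleC mult.commute)
        also have "\<dots> = (\<Sum>s\<in>S. ?r x s *\<^sub>C f s)"
          using S(1) f(2) by (intro sum.cong refl) (simp add: sumr subset_iff)
        also have "\<dots> = f (\<Sum>s\<in>S. ?r x s *\<^sub>C s)" by (simp add: clinearD[OF f(1)])
        finally show ?thesis using sumr[OF that] by simp
      qed
      moreover have "sum g I x = (\<Sum>i\<in>I. g i x)" for g :: "'a \<Rightarrow> 'a \<Rightarrow> 'a" and I
        by (induction I rule: infinite_finite_induct) auto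
      ultimately show "restr W f x = (\<Sum>s\<in>S. \<Sum>w\<in>S. ?r (f s) w *\<^sub>C e s w) x"
        by (simp add: e_def restr_def scaleC_fun_def)
    qed
    then show ?thesis
      by (simp only:) (intro complex_vector.span_sum complex_vector.span_scale complex_vector.span_base, auto)
  qed
  moreover have "finite ((\<lambda>(s, w). e s w) ` (S \<times> S))" using finS by blast
  ultimately show ?thesis using that by blast
qed

text \<open>The commutator with \<open>h\<close> is a linear map on the finite-dimensional space End
  W, so it cannot have infinitely many eigenvalues.\<close>

lemma ad_eigenvectors_vanish:
  fixes y :: "nat \<Rightarrow> 'v::complex_vector \<Rightarrow> 'v"
  assumes W: "finite_dimensional W" and h: "clinear h" "\<And>w. w \<in> W \<Longrightarrow> h w \<in> W"
    and y: "\<And>k. clinear (y k)" "\<And>k w. w \<in> W \<Longrightarrow> y k w \<in> W"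
    and ad: "\<And>k w. w \<in> W \<Longrightarrow> h (y k w) - y k (h w) = \<beta> k *\<^sub>C y k w" and "inj \<beta>"
  shows "\<exists>k. \<forall>w\<in>W. y k w = 0"
proof -
  from restr_finite_dimensional[OF W] obtain G where G: "finite G"
    "\<And>f. clinear f \<Longrightarrow> (\<And>w. w \<in> W \<Longrightarrow> f w \<in> W) \<Longrightarrow> restr W f \<in> complex_vector.span G" by blast
  let ?T = "\<lambda>g. restr W (\<lambda>x. h (g x) - g (h x))"
  have "\<exists>k. restr W (y k) = 0"
  proof (rule exists_zero_of_distinct_eigenvalues[OF _ _ \<open>inj \<beta>\<close> G(1)])
    show "clinear ?T"
      by (auto simp: clinear_iff restr_def fun_eq_iff scaleC_fun_def clinearD[OF h(1)]
          complex_vector.scale_right_diff_distrib)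
    show "?T (restr W (y k)) = \<beta> k *\<^sub>C restr W (y k)" for k
      by (auto simp: restr_def fun_eq_iff scaleC_fun_def ad h)
  qed (use G y in blast)
  then show ?thesis by (metis restr_def zero_fun_apply)
qed

text \<open>By the Leibniz rule the commutator with \<open>h\<close> multiplies
  \<open>y ^^ k\<close> by \<open>k * c\<close>; these factors are distinct, so some power vanishes
  on \<open>W\<close>.\<close>

lemma ad_eigenvector_nilpotent:
  fixes y :: "'v::complex_vector \<Rightarrow> 'v"
  assumes W: "finite_dimensional W" and h: "clinear h" "\<And>w. w \<in> W \<Longrightarrow> h w \<in> W"
    and y: "clinear y" "\<And>w. w \<in> W \<Longrightarrow> y w \<in> W"
    and ad: "\<And>w. w \<in> W \<Longrightarrow> h (y w) - y (h w) = c *\<^sub>C y w" and "c \<noteq> 0"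
  shows "\<exists>k. \<forall>w\<in>W. (y ^^ k) w = 0"
proof (rule ad_eigenvectors_vanish[OF W h])
  have lin: "clinear (y ^^ k)" for k
    by (induction k) (auto simp: clinear_iff clinearD[OF y(1)])
  have pres: "w \<in> W \<Longrightarrow> (y ^^ k) w \<in> W" for k w by (induction k) (auto simp: y)
  show "clinear (y ^^ k)" for k by (rule lin)
  show "w \<in> W \<Longrightarrow> (y ^^ k) w \<in> W" for k w by (rule pres)
  show "h ((y ^^ k) w) - (y ^^ k) (h w) = (of_nat k * c) *\<^sub>C (y ^^ k) w" if w: "w \<in> W" for k w
  proof (induction k)
    case (Suc k)
    have "h ((y ^^ Suc k) w) - (y ^^ Suc k) (h w)
      = (h (y ((y ^^ k) w)) - y (h ((y ^^ k) w))) + y (h ((y ^^ k) w) - (y ^^ k) (h w))"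
      by (simp add: clinearD[OF y(1)])
    also have "\<dots> = c *\<^sub>C y ((y ^^ k) w) + (of_nat k * c) *\<^sub>C y ((y ^^ k) w)"
      using ad[OF pres[OF w]] Suc by (simp add: clinearD[OF y(1)])
    finally show ?case by (simp add: algebra_simps scaleC_add_left)
  qed simp
  show "inj (\<lambda>k. of_nat k * c)" using \<open>c \<noteq> 0\<close> by (auto intro: injI)
qed

lemma span_closed:
  assumes f: "clinear f" and G: "\<And>g. g \<in> G \<Longrightarrow> f g \<in> complex_vector.span G"
    and v: "v \<in> complex_vector.span G"
  shows "f v \<in> complex_vector.span G"
  using v
proof (induction rule: complex_vector.span_induct_alt)
  case base
  show ?case by (simp add: clinearD(3)[OF f] complex_vector.span_zero)
next
  case (step c x y)
  show ?case unfolding clinearD(1,2)[OF f]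
    by (intro complex_vector.span_add complex_vector.span_scale G step)
qed

section \<open>Derivations of Laurent polynomials\<close>

text \<open>These are the vector fields g t_i d/dt_i with an arbitrary coefficient g, whereas
  \<open>D\<close> has monomial coefficients only.\<close>

lift_definition mult_euler :: "'n \<Rightarrow> 'n::finite laurent \<Rightarrow> 'n der" is "\<lambda>i g f. g * euler i f"
  by (intro derivation_mult derivation_euler)

lemma tpow_mult: "tpow r * tpow s = (tpow (r + s) :: 'n::finite laurent)"
  by (simp add: tpow_def mult_single)

lemma tpow_zero: "tpow 0 = (1 :: 'n::finite laurent)"
  by (simp add: tpow_def)

lemma euler_tpow: "euler i (tpow s) = of_int (s $ i) *\<^sub>C tpow s"
  by (simp add: tpow_def euler_single scaleC_single scaleC_complex_def)

lemma mult_euler_single: "mult_euler i (Poly_Mapping.single r c) = D (axis i c) r"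
proof (rule der_eqI, rule derivation_eqI_tpow[OF derivation_der_apply derivation_der_apply])
  fix s
  have "Poly_Mapping.single r c = c *\<^sub>C tpow r"
    by (simp add: tpow_def scaleC_single scaleC_complex_def)
  moreover have "dot (axis i c) s = c * of_int (s $ i)"
    by (simp add: dot_def axis_def if_distrib[where f="\<lambda>x. x * _"] cong: if_cong)
  ultimately show "der_apply (mult_euler i (Poly_Mapping.single r c)) (tpow s) = der_apply (D (axis i c) r) (tpow s)"
    by (simp add: mult_euler.rep_eq D_tpow euler_tpow scaleC_laurent_mult_left
      scaleC_laurent_mult_right tpow_mult scaleC_scaleC)
qed

lemma additive_int_vec:
  fixes \<psi> :: "int ^ 'n::finite \<Rightarrow> 'a::complex_vector"
  assumes add: "\<And>r s. \<psi> (r + s) = \<psi> r + \<psi> s"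
  shows "\<psi> s = (\<Sum>i\<in>UNIV. of_int (s $ i) *\<^sub>C \<psi> (axis i 1))"
proof -
  have zero: "\<psi> 0 = 0" using add[of 0 0] by simp
  have minus: "\<psi> (- r) = - \<psi> r" for r
    using add[of r "- r"] zero by (simp add: eq_neg_iff_add_eq_0 add.commute)
  have axis_add: "axis i (k + l) = axis i k + (axis i l :: int ^ 'n)" for i k l
    by (simp add: vec_eq_iff axis_def)
  have "\<psi> (axis i (of_nat k)) = of_nat k *\<^sub>C \<psi> (axis i 1)" for i k
  proof (induction k)
    case 0
    have "axis i 0 = (0 :: int ^ 'n)" by (simp add: vec_eq_iff axis_def)
    then show ?case by (simp only: of_nat_0 zero complex_vector.scale_zero_left)
  qed (simp add: axis_add add scaleC_add_left scaleC_one)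
  moreover have "axis i (- k) = - (axis i k :: int ^ 'n)" for i k
    by (simp add: vec_eq_iff axis_def)
  ultimately have axis: "\<psi> (axis i k) = of_int k *\<^sub>C \<psi> (axis i 1)" for i k
    by (cases k rule: int_cases2) (simp_all add: minus)
  have sum: "\<psi> (sum f I) = (\<Sum>i\<in>I. \<psi> (f i))" for f and I :: "'n set"
    by (induction I rule: infinite_finite_induct) (simp_all add: zero add)
  have "s = (\<Sum>i\<in>UNIV. axis i (s $ i))"
    by (simp add: vec_eq_iff axis_def)
  then have "\<psi> s = (\<Sum>i\<in>UNIV. \<psi> (axis i (s $ i)))" using sum by metis
  then show ?thesis by (simp add: axis[symmetric])
qed

text \<open>With \<open>\<psi> s = t\<^sup>-\<^sup>s d(t\<^sup>s)\<close>, which is additive in \<open>s\<close>, the derivation \<open>d\<close> is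
  \<open>\<Sum>\<^sub>i \<psi>(e\<^sub>i) t\<^sub>i d/dt\<^sub>i\<close>.\<close>

lemma der_induct [case_names zero D add]:
  fixes d :: "'n::finite der"
  assumes "P 0" "\<And>u r. P (D u r)" "\<And>d e. P d \<Longrightarrow> P e \<Longrightarrow> P (d + e)"
  shows "P d"
proof -
  let ?d = "der_apply d"
  note deriv = derivation_der_apply[of d, unfolded derivation_iff]
  define \<psi> where "\<psi> s = tpow (- s) * ?d (tpow s)" for s
  have "\<psi> (r + s) = \<psi> r + \<psi> s" for r s
  proof -
    have "?d (tpow (r + s)) = ?d (tpow r) * tpow s + tpow r * ?d (tpow s)"
      using deriv by (simp flip: tpow_mult)
    then have "\<psi> (r + s) = tpow (- r) * ?d (tpow r) * (tpow (- s) * tpow s)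
      + (tpow (- r) * tpow r) * (tpow (- s) * ?d (tpow s))"
      by (simp add: \<psi>_def algebra_simps tpow_mult[of "- r" "- s", simplified, symmetric])
    then show ?thesis by (simp add: \<psi>_def tpow_mult tpow_zero)
  qed
  then have \<psi>: "\<psi> s = (\<Sum>i\<in>UNIV. of_int (s $ i) *\<^sub>C \<psi> (axis i 1))" for s
    by (rule additive_int_vec)
  have apply_sum: "der_apply (sum g I) f = (\<Sum>i\<in>I. der_apply (g i) f)" for g :: "'n \<Rightarrow> 'n der" and I f
    by (induction I rule: infinite_finite_induct) (simp_all add: zero_der.rep_eq plus_der.rep_eq)
  have d: "d = (\<Sum>i\<in>UNIV. mult_euler i (\<psi> (axis i 1)))"
  proof (rule der_eqI, rule derivation_eqI_tpow[OF derivation_der_apply derivation_der_apply])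
    fix s
    have "?d (tpow s) = (tpow s * tpow (- s)) * ?d (tpow s)"
      by (simp add: tpow_mult tpow_zero)
    also have "\<dots> = tpow s * \<psi> s"
      by (simp only: \<psi>_def mult.assoc)
    also have "\<dots> = (\<Sum>i\<in>UNIV. \<psi> (axis i 1) * euler i (tpow s))"
      by (subst \<psi>) (simp add: sum_distrib_left euler_tpow scaleC_laurent_mult_right mult.commute)
    finally show "?d (tpow s) = der_apply (\<Sum>i\<in>UNIV. mult_euler i (\<psi> (axis i 1))) (tpow s)"
      by (simp add: apply_sum mult_euler.rep_eq)
  qed
  have mult: "P (mult_euler i f)" for i f
  proof (induction f rule: poly_mapping_add_induct)
    case zero
    have "mult_euler i 0 = 0" by transfer simp
    with assms(1) show ?case by simp
  next
    case (single k c)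
    with assms(2) show ?case by (simp add: mult_euler_single)
  next
    case (add f g)
    have "mult_euler i (f + g) = mult_euler i f + mult_euler i g"
      by transfer (simp add: algebra_simps)
    with add assms(3) show ?case by simp
  qed
  have "P (\<Sum>i\<in>I. mult_euler i (g i))" for g I
    by (induction I rule: infinite_finite_induct) (auto simp: assms(1,3) mult)
  then show ?thesis by (subst d)
qed

lemma dot_axis: "dot u (axis i k) = u $ i * of_int k"
  by (simp add: dot_def axis_def if_distrib[where f=of_int] if_distrib[where f="\<lambda>x. _ * x"] cong: if_cong)

lemma dot_zero_right [simp]: "dot u 0 = 0"
  by (simp add: dot_def)

lemma dot_minus: "dot u (- r) = - dot u r"
  by (simp add: dot_def sum_negf)

lemma dot_add_left: "dot (u + v) r = dot u r + dot v r"
  by (simp add: dot_def algebra_simps sum.distrib)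

text \<open>Along the multiples of a coordinate vector whose pairing with \<open>v\<close> is
  nonzero, the pairing takes infinitely many values.\<close>

lemma exists_dot_notin:
  fixes v :: "complex ^ 'n::finite"
  assumes "v \<noteq> 0" "finite F" obtains t :: "int ^ 'n" where "dot v t \<notin> F"
proof -
  obtain i where "v $ i \<noteq> 0" using assms(1) by (auto simp: vec_eq_iff)
  then have "inj (\<lambda>k. dot v (axis i k))" by (auto intro!: injI simp: dot_axis)
  then have "infinite (range (\<lambda>k. dot v (axis i k)))" by (simp add: finite_image_iff)
  then have "\<not> range (\<lambda>k. dot v (axis i k)) \<subseteq> F" using assms(2) finite_subset by blast
  then show ?thesis using that by blast
qed

lemma tens_zero_left: "0 \<otimes> b = 0"
  using tens_simps(4)[of 0 0 b] by simp

section \<open>Modules with associative action\<close>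

locale tau_module =
  fixes act :: "('n::finite, 'b::complex_comm_algebra) tau \<Rightarrow> 'v::complex_vector \<Rightarrow> 'v"
  assumes irreducible: "irreducible_lie_module act"
    and weight: "weight_module act"
    and fin: "\<And>l. l \<in> dual_of cartan \<Longrightarrow> finite_dimensional (weight_space act l)"
    and assoc: "\<And>r s b b' v. act (inA (tpow r) \<otimes> b) (act (inA (tpow s) \<otimes> b') v)
      = act (inA (tpow (r + s)) \<otimes> (b * b')) v"
    and unit: "\<And>v. act (inA (tpow 0) \<otimes> 1) v = v"
begin

lemma cbilinear_act: "cbilinear act"
  using irreducible by (simp add: irreducible_lie_module_def lie_module_def)

lemma clinear_act: "clinear (act x)" and clinear_act_left: "clinear (\<lambda>x. act x v)"
  using cbilinear_act by (auto simp: cbilinear_def)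

lemma act_bracket: "act x (act y v) = act y (act x v) + act \<lbrakk>x, y\<rbrakk>\<^sub>L v"
  using irreducible by (simp add: irreducible_lie_module_def lie_module_def)

lemma exists_nonzero: "\<exists>v::'v. v \<noteq> 0"
  using irreducible by (auto simp: irreducible_lie_module_def)

text \<open>Monomials span A and the \<open>D u r\<close> span Der A, so membership has to be
  checked on these only.\<close>

lemma act_in_subspace:
  assumes S: "complex_vector.subspace S"
    and A: "\<And>r. act (inA (tpow r) \<otimes> b) w \<in> S" and Der: "\<And>u r. act (inDer (D u r) \<otimes> b) w \<in> S"
  shows "act (X \<otimes> b) w \<in> S"
proof -
  note lin = clinearD[OF clinear_act_left[of w]]
  have "act (inA f \<otimes> b) w \<in> S" for f
  proof (induction f rule: poly_mapping_add_induct)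
    case zero
    then show ?case using complex_vector.subspace_0[OF S] by (simp add: tens_zero_left lin flip: zero_ader_def)
  next
    case (single k c)
    have "inA (Poly_Mapping.single k c) = c *\<^sub>C inA (tpow k)"
      using complex_vector.scale_zero_right[of c] by (simp add: tpow_def scaleC_single scaleC_complex_def scaleC_ader_def)
    then show ?case using complex_vector.subspace_scale[OF S A] by (simp add: tens_simps lin)
  next
    case (add f g)
    have "inA (f + g) = inA f + inA g" by (simp add: plus_ader_def)
    with add show ?case using complex_vector.subspace_add[OF S] by (simp add: tens_simps lin)
  qed
  moreover have "act (inDer d \<otimes> b) w \<in> S" for d
  proof (induction d rule: der_induct)
    case zero
    then show ?case using complex_vector.subspace_0[OF S] by (simp add: tens_zero_left lin flip: zero_ader_def)
  next
    case (D u r)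
    show ?case by (rule Der)
  next
    case (add d e)
    have "inDer (d + e) = inDer d + inDer e" by (simp add: plus_ader_def)
    with add show ?case using complex_vector.subspace_add[OF S] by (simp add: tens_simps lin)
  qed
  moreover have "X = inA (fun_part X) + inDer (der_part X)"
    by (simp add: plus_ader_def)
  ultimately show ?thesis
    using complex_vector.subspace_add[OF S] by (metis lin(1) tens_simps(2))
qed

lemma act_eq_0I:
  assumes "\<And>r. act (inA (tpow r) \<otimes> b) v = 0" "\<And>u r. act (inDer (D u r) \<otimes> b) v = 0"
  shows "act (X \<otimes> b) v = 0"
  using act_in_subspace[of "{0}" b v X] assms by simp

text \<open>Pure tensors generate \<tau> additively, so stability under them already makes
  \<open>S\<close> a submodule.\<close>

lemma submodule_eq_UNIV:
  assumes S: "complex_vector.subspace S" and closed: "\<And>X b w. w \<in> S \<Longrightarrow> act (X \<otimes> b) w \<in> S"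
    and w: "w \<in> S" "w \<noteq> 0"
  shows "S = UNIV"
proof -
  have "act x w \<in> S" if "w \<in> S" for x w
  proof (induction x rule: tensor_induct)
    case zero
    then show ?case using complex_vector.subspace_0[OF S] by (simp add: clinearD[OF clinear_act_left])
  next
    case (add s t)
    then show ?case using complex_vector.subspace_add[OF S] by (simp add: clinearD[OF clinear_act_left])
  qed (rule closed[OF that])
  with S have "lie_submodule act S" by (auto simp: lie_submodule_def)
  then show ?thesis using irreducible w by (auto simp: irreducible_lie_module_def)
qed

section \<open>A fixed nonzero weight space\<close>

definition weight_of :: "'n ader \<Rightarrow> complex" where
  "weight_of = (SOME l. l \<in> dual_of cartan \<and> weight_space act l \<noteq> {0})"

definition W :: "'v set" where "W = weight_space act weight_of"

text \<open>A nonzero vector has a nonzero component in its weight decomposition, so there is a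
  weight to choose.\<close>

lemma weight_of: "weight_of \<in> dual_of cartan" "weight_space act weight_of \<noteq> {0}"
proof -
  obtain v :: 'v where "v \<noteq> 0" using exists_nonzero by blast
  from weight obtain f where f: "\<forall>i\<in>dual_of cartan. f i \<in> weight_space act i"
    "\<forall>i. i \<notin> dual_of cartan \<longrightarrow> f i = 0" "v = (\<Sum>i | f i \<noteq> 0. f i)"
    unfolding weight_module_def is_direct_sum_def by metis
  with \<open>v \<noteq> 0\<close> obtain l where "f l \<noteq> 0" by (metis (mono_tags, lifting) sum.neutral)
  with f have "\<exists>l. l \<in> dual_of cartan \<and> weight_space act l \<noteq> {0}" by blast
  then have "weight_of \<in> dual_of cartan \<and> weight_space act weight_of \<noteq> {0}"
    unfolding weight_of_def by (rule someI_ex)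
  then show "weight_of \<in> dual_of cartan" "weight_space act weight_of \<noteq> {0}" by auto
qed

lemma subspace_W: "complex_vector.subspace W"
  by (auto simp: W_def weight_space_def complex_vector.subspace_def clinearD[OF clinear_act]
      scaleC_add_right scaleC_scaleC mult.commute)

lemma finite_dimensional_W: "finite_dimensional W"
  unfolding W_def by (rule fin[OF weight_of(1)])

lemma W_nonzero: obtains w where "w \<in> W" "w \<noteq> 0"
  using weight_of(2) complex_vector.subspace_0[OF subspace_W] unfolding W_def by blast

lemma W_span: obtains B where "finite B" "W = complex_vector.span B"
  using finite_dimensional_W by (auto simp: finite_dimensional_def)

text \<open>Besides the span of the \<open>D u 0\<close>, the algebra H contains only multiples of
  t^0, which acts as the identity; hence commuting with the \<open>D u 0\<close> suffices.\<close>

lemma W_closed: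
  assumes f: "clinear f"
    and comm: "\<And>u v. act (inDer (D u 0) \<otimes> 1) (f v) = f (act (inDer (D u 0) \<otimes> 1) v)"
    and w: "w \<in> W"
  shows "f w \<in> W"
proof -
  note lin = clinearD[OF clinear_act_left]
  have der: "act (h \<otimes> 1) (f v) = f (act (h \<otimes> 1) v)" if "h \<in> cartan_der" for h v
    using that unfolding cartan_der_def
  proof (induction rule: complex_vector.span_induct_alt)
    case base
    then show ?case by (simp add: tens_zero_left lin clinearD[OF f])
  next
    case (step c x y)
    then show ?case by (auto simp: tens_simps lin clinearD[OF f] comm)
  qed
  have "act (h \<otimes> 1) (f v) = f (act (h \<otimes> 1) v)" if "h \<in> cartan" for h v
    using that der unfolding cartan_def by (auto simp: tens_simps lin clinearD[OF f] unit)
  with w show ?thesis by (auto simp: W_def weight_space_def clinearD[OF f])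
qed

section \<open>Schur's lemma for the central elements t^0 b\<close>

lemma act_central: "act (inA (tpow 0) \<otimes> b) (act (X \<otimes> b') v) = act (X \<otimes> b') (act (inA (tpow 0) \<otimes> b) v)"
proof -
  \<comment> \<open>Derivations kill constants, which makes t^0 b central in \<tau>.\<close>
  have der: "der_apply d (tpow 0) = 0" for d :: "'n der"
  proof -
    have "der_apply d (1 * 1) = der_apply d 1 * 1 + 1 * der_apply d 1"
      using derivation_der_apply[of d] unfolding derivation_iff by blast
    then show ?thesis by (simp add: tpow_zero)
  qed
  have lie0: "\<lbrakk>0, d\<rbrakk>\<^sub>L = 0" for d :: "'n der" using lie_scaleC_left[of 0 0 d] by simp
  have "\<lbrakk>inA (tpow 0), X\<rbrakk>\<^sub>L = 0"
    by (simp add: lie_bracket_ader_def zero_ader_def zero_der.rep_eq der lie0)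
  then have "\<lbrakk>inA (tpow 0) \<otimes> b, X \<otimes> b'\<rbrakk>\<^sub>L = 0" by (simp add: lie_bracket_tens tens_zero_left)
  then show ?thesis
    using act_bracket[of "inA (tpow 0) \<otimes> b" "X \<otimes> b'" v] by (simp add: clinearD[OF clinear_act_left])
qed

text \<open>A central operator preserves the finite-dimensional \<open>W\<close> and has an
  eigenvector there; its eigenspace in V is a nonzero submodule.\<close>

lemma act_scalar: "\<exists>c. \<forall>v. act (inA (tpow 0) \<otimes> b) v = c *\<^sub>C v"
proof -
  obtain B where B: "finite B" "W = complex_vector.span B" by (rule W_span)
  obtain w where w: "w \<in> W" "w \<noteq> 0" by (rule W_nonzero)
  have "act (inA (tpow 0) \<otimes> b) x \<in> W" if "x \<in> W" for x
    by (rule W_closed[OF clinear_act _ that]) (rule act_central[symmetric])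
  then have "\<exists>y\<in>W. \<exists>c. y \<noteq> 0 \<and> act (inA (tpow 0) \<otimes> b) y = c *\<^sub>C y"
    by (rule exists_eigenvector[OF clinear_act subspace_W _ B(1) eq_refl[OF B(2)] w])
  then obtain y c where y: "y \<noteq> 0" "act (inA (tpow 0) \<otimes> b) y = c *\<^sub>C y" by blast
  have "{v. act (inA (tpow 0) \<otimes> b) v = c *\<^sub>C v} = UNIV"
  proof (rule submodule_eq_UNIV[OF _ _ _ y(1)])
    show "complex_vector.subspace {v. act (inA (tpow 0) \<otimes> b) v = c *\<^sub>C v}"
      by (auto simp: complex_vector.subspace_def clinearD[OF clinear_act] scaleC_add_right
          scaleC_scaleC mult.commute)
  qed (auto simp: act_central y clinearD[OF clinear_act])
  then show ?thesis by blast
qed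

definition \<theta> :: "'b \<Rightarrow> complex" where
  "\<theta> b = (SOME c. \<forall>v. act (inA (tpow 0) \<otimes> b) v = c *\<^sub>C v)"

lemma act_tpow_zero: "act (inA (tpow 0) \<otimes> b) v = \<theta> b *\<^sub>C v"
  using someI_ex[OF act_scalar[of b]] unfolding \<theta>_def by (rule spec)

lemma \<theta>_eqI:
  assumes "\<And>v. act (inA (tpow 0) \<otimes> b) v = c *\<^sub>C v" shows "\<theta> b = c"
proof -
  obtain v :: 'v where "v \<noteq> 0" using exists_nonzero by blast
  moreover have "\<theta> b *\<^sub>C v = c *\<^sub>C v"
    by (rule trans[OF act_tpow_zero[symmetric] assms])
  ultimately show ?thesis by simp
qed

text \<open>Linearity of the action and associativity make \<open>\<theta>\<close> a character of
  B.\<close>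

lemma \<theta>_simps [simp]:
  "\<theta> 1 = 1" "\<theta> (a + b) = \<theta> a + \<theta> b" "\<theta> (c *\<^sub>C a) = c * \<theta> a" "\<theta> (a * b) = \<theta> a * \<theta> b"
  "\<theta> (a - b) = \<theta> a - \<theta> b"
proof -
  note lin = clinearD[OF clinear_act_left]
  show "\<theta> 1 = 1"
    by (rule \<theta>_eqI) (simp only: unit scaleC_one)
  show add: "\<theta> (a + b) = \<theta> a + \<theta> b" for a b
    by (rule \<theta>_eqI) (simp only: tens_simps(1) lin(1) act_tpow_zero scaleC_add_left)
  show "\<theta> (c *\<^sub>C a) = c * \<theta> a"
    by (rule \<theta>_eqI) (simp only: tens_simps(3) lin(2) act_tpow_zero scaleC_scaleC)
  show "\<theta> (a * b) = \<theta> a * \<theta> b"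
  proof (rule \<theta>_eqI)
    fix v
    have "act (inA (tpow 0) \<otimes> (a * b)) v = act (inA (tpow 0) \<otimes> a) (act (inA (tpow 0) \<otimes> b) v)"
      by (simp only: assoc add_0_left)
    then show "act (inA (tpow 0) \<otimes> (a * b)) v = (\<theta> a * \<theta> b) *\<^sub>C v"
      by (simp only: act_tpow_zero scaleC_scaleC)
  qed
  show "\<theta> (a - b) = \<theta> a - \<theta> b"
    using add[of "a - b" b] by (simp add: algebra_simps)
qed

section \<open>Commutation relations of the operators t^-r D(u,r)b\<close>

definition T :: "int ^ 'n \<Rightarrow> 'v \<Rightarrow> 'v" where "T r = act (inA (tpow r) \<otimes> 1)"

definition DD :: "complex ^ 'n \<Rightarrow> int ^ 'n \<Rightarrow> 'b \<Rightarrow> 'v \<Rightarrow> 'v"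
  where "DD u r b = act (inDer (D u r) \<otimes> b)"

definition Y :: "complex ^ 'n \<Rightarrow> int ^ 'n \<Rightarrow> 'b \<Rightarrow> 'v \<Rightarrow> 'v"
  where "Y u r b v = T (- r) (DD u r b v)"

lemma clinear_T: "clinear (T r)" and clinear_DD: "clinear (DD u r b)"
  by (simp_all add: T_def DD_def clinear_act)

lemmas T_lin = clinearD[OF clinear_T]
lemmas DD_lin = clinearD[OF clinear_DD]

lemma clinear_Y: "clinear (Y u r b)"
  by (simp add: clinear_iff Y_def T_lin DD_lin)

lemmas Y_lin = clinearD[OF clinear_Y]

lemma T_T: "T r (T s v) = T (r + s) v"
  using assoc[of r 1 s 1 v] by (simp add: T_def)

lemma T_zero [simp]: "T 0 v = v"
  by (simp add: T_def unit)

text \<open>Associativity factors t^r b into t^0 b followed by t^r; in particular A \<otimes> ker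
  \<theta> acts by zero.\<close>

lemma act_tpow: "act (inA (tpow r) \<otimes> b) v = \<theta> b *\<^sub>C T r v"
  using assoc[of r 1 0 b v] by (simp add: act_tpow_zero T_lin flip: T_def)

lemma DD_T: "DD u r b (T s v) = T s (DD u r b v) + (dot u s * \<theta> b) *\<^sub>C T (r + s) v"
  using act_bracket[of "inDer (D u r) \<otimes> b" "inA (tpow s) \<otimes> 1" v]
  by (simp add: lie_bracket_tens lie_bracket_inDer_inA tens_simps clinearD[OF clinear_act_left]
      act_tpow scaleC_scaleC flip: DD_def)

lemma D_linear: "D (u + v) r = D u r + D v r" "D (c *s u) r = c *\<^sub>C D u r"
  by (transfer, simp add: fun_eq_iff scaleC_add_left sum.distrib complex_vector.scale_sum_right scaleC_scaleC)+

lemma DD_simps: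
  "DD (u + v) r b w = DD u r b w + DD v r b w" "DD (c *s u) r b w = c *\<^sub>C DD u r b w"
  "DD u r (a + b) w = DD u r a w + DD u r b w" "DD u r (c *\<^sub>C b) w = c *\<^sub>C DD u r b w"
proof -
  note lin = clinearD[OF clinear_act_left]
  have "inDer (d + e) = inDer d + inDer e" for d e :: "'n der" by (simp add: plus_ader_def)
  then show "DD (u + v) r b w = DD u r b w + DD v r b w"
    by (simp add: DD_def D_linear tens_simps lin)
  have "inDer (c *\<^sub>C d) = c *\<^sub>C inDer d" for d :: "'n der" by (simp add: scaleC_ader_def)
  then show "DD (c *s u) r b w = c *\<^sub>C DD u r b w"
    by (simp add: DD_def D_linear tens_simps lin)
  show "DD u r (a + b) w = DD u r a w + DD u r b w" "DD u r (c *\<^sub>C b) w = c *\<^sub>C DD u r b w"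
    by (simp_all add: DD_def tens_simps lin)
qed

lemma Y_simps:
  "Y (u + v) r b w = Y u r b w + Y v r b w" "Y (c *s u) r b w = c *\<^sub>C Y u r b w"
  "Y u r (a + b) w = Y u r a w + Y u r b w" "Y u r (c *\<^sub>C b) w = c *\<^sub>C Y u r b w"
  by (simp_all add: Y_def DD_simps T_lin)

lemma Y_minus:
  "Y (u - v) r b w = Y u r b w - Y v r b w" "Y u r (a - b) w = Y u r a w - Y u r b w"
  using Y_simps(1)[of "u - v" v r b w] Y_simps(3)[of u r "a - b" b w] by simp_all

lemma Y_zero: "Y 0 r b w = 0" "Y u r 0 w = 0"
  using Y_minus(1)[of 0 0] Y_minus(2)[of u r 0 0] by simp_all

lemma DD_DD:
  "DD u r b (DD v s b' w) = DD v s b' (DD u r b w)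
    + (dot u s *\<^sub>C DD v (r + s) (b * b') w - dot v r *\<^sub>C DD u (r + s) (b * b') w)"
proof -
  have "(\<chi> i. dot u s * v $ i - dot v r * u $ i) = dot u s *s v + (- dot v r) *s u"
    by (simp add: vec_eq_iff)
  then have "DD u r b (DD v s b' w) = DD v s b' (DD u r b w)
      + DD (dot u s *s v + (- dot v r) *s u) (r + s) (b * b') w"
    using act_bracket[of "inDer (D u r) \<otimes> b" "inDer (D v s) \<otimes> b'" w]
    by (simp add: lie_bracket_tens lie_bracket_inDer_inDer lie_bracket_D flip: DD_def)
  then show ?thesis by (simp only: DD_simps) (simp add: algebra_simps)
qed

lemma Y_T: "Y u r b (T s w) = T s (Y u r b w) + (dot u s * \<theta> b) *\<^sub>C T s w"
  by (simp add: Y_def DD_T T_lin T_T algebra_simps)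

text \<open>The bracket of the two derivations gives the first two terms. Moving
  \<open>T (- s)\<close> and \<open>T (- r)\<close> past the derivations gives the two corrections,
  which disappear when \<open>\<theta> b\<close> and \<open>\<theta> b'\<close> are zero.\<close>

lemma Y_Y: "Y u r b (Y v s b' w) - Y v s b' (Y u r b w) =
    dot u s *\<^sub>C Y v (r + s) (b * b') w - dot v r *\<^sub>C Y u (r + s) (b * b') w
    - (\<theta> b * dot u s) *\<^sub>C Y v s b' w + (\<theta> b' * dot v r) *\<^sub>C Y u r b w"
proof -
  have *: "Y u r b (Y v s b' w) = T (- r - s) (DD u r b (DD v s b' w)) - (\<theta> b * dot u s) *\<^sub>C Y v s b' w"
    for u r b v s b'
    by (simp add: Y_def DD_T T_lin T_T dot_minus algebra_simps)
  have "T (- s - r) = T (- r - s)" by (rule arg_cong[of _ _ T]) simp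
  then show ?thesis
    unfolding * by (subst DD_DD) (simp add: Y_def T_lin algebra_simps)
qed

lemma Y_W: assumes "w \<in> W" shows "Y u r b w \<in> W"
proof (rule W_closed[OF clinear_Y _ assms])
  fix v w
  \<comment> \<open>In \<open>Y_Y\<close> the terms with factor \<open>dot v r\<close> cancel and
    those with \<open>dot u 0\<close> vanish, so D(v,0) commutes with
    \<open>Y u r b\<close>.\<close>
  have "Y v 0 1 (Y u r b w) = Y u r b (Y v 0 1 w)"
    using Y_Y[of v 0 1 u r b w] by (simp add: algebra_simps)
  then show "act (inDer (D v 0) \<otimes> 1) (Y u r b w) = Y u r b (act (inDer (D v 0) \<otimes> 1) w)"
    by (simp add: Y_def[of v] DD_def)
qed

text \<open>\<open>DD u r b\<close> is \<open>Y u r b\<close> followed by \<open>T r\<close>, and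
  \<open>Y u r b\<close> preserves \<open>W\<close>; hence the translates of \<open>W\<close> span a
  nonzero submodule.\<close>

lemma span_T_W: "complex_vector.span {T s w | s w. w \<in> W} = UNIV"
proof -
  let ?G = "{T s w | s w. w \<in> W}"
  obtain w where w: "w \<in> W" "w \<noteq> 0" by (rule W_nonzero)
  have T: "T s v \<in> complex_vector.span ?G" if "v \<in> W" for s v
    using that by (intro complex_vector.span_base) blast
  have T': "T r v \<in> complex_vector.span ?G" if "v \<in> complex_vector.span ?G" for r v
    by (rule span_closed[OF clinear_T _ that]) (auto simp: T_T T)
  have DD: "DD u r b v \<in> complex_vector.span ?G" if "v \<in> complex_vector.span ?G" for u r b v
  proof (rule span_closed[OF clinear_DD _ that])
    fix g assume "g \<in> ?G"
    then obtain s v where g: "g = T s v" "v \<in> W" by blast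
    have "DD u r b v = T r (Y u r b v)" by (simp add: Y_def T_T)
    then have "DD u r b g = T (s + r) (Y u r b v) + (dot u s * \<theta> b) *\<^sub>C T (r + s) v"
      by (simp add: g DD_T T_T)
    then show "DD u r b g \<in> complex_vector.span ?G"
      using T Y_W g(2) by (simp only:) (intro complex_vector.span_add complex_vector.span_scale T Y_W)
  qed
  show ?thesis
  proof (rule submodule_eq_UNIV[OF complex_vector.subspace_span _ _ w(2)])
    show "w \<in> complex_vector.span ?G" using T[OF w(1), of 0] by simp
    fix X b v assume v: "v \<in> complex_vector.span ?G"
    show "act (X \<otimes> b) v \<in> complex_vector.span ?G"
    proof (rule act_in_subspace[OF complex_vector.subspace_span])
      show "act (inA (tpow r) \<otimes> b) v \<in> complex_vector.span ?G" for r
        unfolding act_tpow by (intro complex_vector.span_scale T' v)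
      show "act (inDer (D u r) \<otimes> b) v \<in> complex_vector.span ?G" for u r
        using DD[OF v] by (simp add: DD_def)
    qed
  qed
qed

text \<open>For \<open>x\<close> in ker \<theta> the operator \<open>Y u r x\<close> commutes with
  every \<open>T s\<close>, and the translates of \<open>W\<close> under the \<open>T s\<close> span
  V.\<close>

lemma Y_eq_0I:
  assumes "\<theta> x = 0" and W: "\<And>w. w \<in> W \<Longrightarrow> Y u r x w = 0"
  shows "Y u r x v = 0"
proof -
  have "v \<in> complex_vector.span {T s w | s w. w \<in> W}" by (simp add: span_T_W)
  then show ?thesis
  proof (induction rule: complex_vector.span_induct_alt)
    case base
    show ?case by (rule Y_lin(3))
  next
    case (step c g y)
    then obtain s w where g: "g = T s w" "w \<in> W" by blast
    have "Y u r x g = 0" by (simp add: g Y_T T_lin W assms(1))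
    with step(2) show ?case by (simp add: Y_lin)
  qed
qed

section \<open>The ideal K of elements acting by zero\<close>

definition K :: "'b \<Rightarrow> bool" where "K x \<longleftrightarrow> \<theta> x = 0 \<and> (\<forall>v t w. Y v t x w = 0)"

text \<open>Bracketing the zero operator \<open>Y v r x\<close> with \<open>Y v' (t - r) b\<close>
  gives \<open>(v, t - r) Y v' t (x b) = (v', r) Y v t (x b)\<close>. The case \<open>v' = v\<close>
  yields \<open>Y v t (x b) = 0\<close>, after which the right side vanishes for every
  \<open>v'\<close>.\<close>

lemma Y_mult_eq_0:
  assumes x: "\<theta> x = 0" "\<And>w. Y v r x w = 0" and b: "\<theta> b = 0"
    and t: "dot v t \<noteq> 2 * dot v r" "dot v t \<noteq> dot v r"
  shows "Y v' t (x * b) w = 0"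
proof -
  have s: "dot v (t - r) = dot v t - dot v r"
    using dot_add[of v "t - r" r] by simp
  have *: "dot v (t - r) *\<^sub>C Y v' t (x * b) w = dot v' r *\<^sub>C Y v t (x * b) w" for v'
    using Y_Y[of v r x v' "t - r" b w] by (simp add: x b Y_lin)
  from *[of v] have "(dot v (t - r) - dot v r) *\<^sub>C Y v t (x * b) w = 0"
    by (simp add: complex_vector.scale_left_diff_distrib)
  then have "Y v t (x * b) w = 0" using t(1) by (simp add: s)
  with *[of v'] t(2) show ?thesis by (simp add: s)
qed

text \<open>Since \<open>Y v r x\<close> vanishes for every \<open>r\<close>, an \<open>r\<close>
  meeting the conditions of \<open>Y_mult_eq_0\<close> can be chosen for each \<open>t\<close>. A
  general \<open>b\<close> differs from an element of ker \<theta> by a scalar.\<close>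

lemma K_mult: assumes "K x" shows "K (x * b)"
proof -
  have ker: "K (x * b)" if b: "\<theta> b = 0" for b
    unfolding K_def
  proof (intro conjI allI)
    show "\<theta> (x * b) = 0" by (simp add: b)
    fix v' t w
    obtain i :: 'n where True by blast
    obtain r where "dot (axis i 1) r \<notin> {dot (axis i 1) t / 2, dot (axis i 1) t}"
      by (rule exists_dot_notin[of "axis i 1" "{dot (axis i 1) t / 2, dot (axis i 1) t}"])
        (auto simp: axis_eq_0_iff)
    with assms b show "Y v' t (x * b) w = 0"
      by (intro Y_mult_eq_0[of x "axis i 1" r]) (auto simp: K_def)
  qed
  have "K (x * (b - \<theta> b *\<^sub>C 1))" by (rule ker) simp
  then have *: "K (x * b - \<theta> b *\<^sub>C x)"
    by (simp add: right_diff_distrib scaleC_mult_right)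
  have "Y v t (x * b) w = 0" for v t w
  proof -
    have "Y v t (x * b) w = Y v t (x * b - \<theta> b *\<^sub>C x) w + \<theta> b *\<^sub>C Y v t x w"
      by (simp add: Y_minus Y_simps)
    then show ?thesis using * assms by (simp add: K_def)
  qed
  then show ?thesis using assms by (simp add: K_def)
qed

lemma K_cube:
  assumes x: "\<theta> x = 0" "\<And>w. Y v r x w = 0" and "v \<noteq> 0"
  shows "K (x * x * x)"
  unfolding K_def
proof (intro conjI allI)
  show "\<theta> (x * x * x) = 0" by (simp add: x)
  fix v' t' w
  \<comment> \<open>The first two excluded values serve the passage from \<open>x\<close> at
    \<open>r\<close> to \<open>x * x\<close> at \<open>t\<close>, the last two that from
    \<open>t\<close> to the given \<open>t'\<close>.\<close>
  obtain t where t: "dot v t \<notin> {2 * dot v r, dot v r, dot v t' / 2, dot v t'}"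
    by (rule exists_dot_notin[OF \<open>v \<noteq> 0\<close>, of "{2 * dot v r, dot v r, dot v t' / 2, dot v t'}"]) auto
  have xx: "Y v t (x * x) w = 0" for w
    by (rule Y_mult_eq_0[of x v r]) (use t in \<open>auto simp: x\<close>)
  show "Y v' t' (x * x * x) w = 0"
    by (rule Y_mult_eq_0[of "x * x" v t]) (use t in \<open>auto simp: x xx\<close>)
qed

section \<open>Nilpotency on the weight space\<close>

lemma nilpotent_Y:
  assumes "\<theta> y = 0" "dot v s \<noteq> 0"
  shows "\<exists>k. \<forall>w\<in>W. (Y v s y ^^ k) w = 0"
proof (rule ad_eigenvector_nilpotent[OF finite_dimensional_W clinear_Y Y_W clinear_Y Y_W])
  \<comment> \<open>The bracket of D(v,s) with D(v,s)y is zero, so only a correction term of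
    \<open>Y_Y\<close> survives.\<close>
  show "Y v s 1 (Y v s y w) - Y v s y (Y v s 1 w) = (- dot v s) *\<^sub>C Y v s y w" for w
    by (subst Y_Y) (simp add: assms(1))
qed (use assms(2) in auto)

text \<open>\<open>Z\<close> comes from the vector field \<open>t + 2 + t\<^sup>-\<^sup>1\<close>, an eigenvector of the bracket with \<open>t - t\<^sup>-\<^sup>1\<close>; it
  makes \<open>Y v 0 y\<close>, which is not itself such an eigenvector, a combination of nilpotent operators.\<close>

abbreviation Z :: "complex ^ 'n \<Rightarrow> int ^ 'n \<Rightarrow> 'b \<Rightarrow> 'v \<Rightarrow> 'v"
  where "Z v s y \<equiv> \<lambda>w. Y v s y w + 2 *\<^sub>C Y v 0 y w + Y v (- s) y w"

lemma nilpotent_Z: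
  assumes y: "\<theta> y = 0" and "dot v s \<noteq> 0"
  shows "\<exists>k. \<forall>w\<in>W. (Z v s y ^^ k) w = 0"
proof (rule ad_eigenvector_nilpotent[OF finite_dimensional_W, where h="\<lambda>w. Y v s 1 w - Y v (- s) 1 w"])
  note W = complex_vector.subspace_add[OF subspace_W] complex_vector.subspace_diff[OF subspace_W]
    complex_vector.subspace_scale[OF subspace_W] Y_W
  show "clinear (\<lambda>w. Y v s 1 w - Y v (- s) 1 w)" "clinear (Z v s y)"
    by (simp_all add: clinear_iff Y_lin scaleC_add_right complex_vector.scale_right_diff_distrib
        scaleC_scaleC mult.commute)
  show "w \<in> W \<Longrightarrow> Y v s 1 w - Y v (- s) 1 w \<in> W" "w \<in> W \<Longrightarrow> Z v s y w \<in> W" for w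
    by (intro W; assumption)+
  show "Y v s 1 (Z v s y w) - Y v (- s) 1 (Z v s y w) - Z v s y (Y v s 1 w - Y v (- s) 1 w)
    = (- 2 * dot v s) *\<^sub>C Z v s y w" for w
  proof -
    note Y1 = Y_Y[of v _ 1 v _ y w, unfolded diff_eq_eq]
    show ?thesis
      by (simp only: Y_lin Y1, simp add: y dot_minus algebra_simps scaleC_add_right scaleC_scaleC
        complex_vector.scale_right_diff_distrib, simp flip: scaleC_add_left)
  qed
qed (use assms(2) in auto)

lemma K_square:
  assumes x: "\<theta> x = 0" and K: "K (x * x)"
  shows "K x"
proof -
  have \<theta>: "\<theta> (b * x) = 0" for b by (simp add: x)
  \<comment> \<open>A product of two elements of Bx is a multiple of x^2 and lies in
    \<open>K\<close>, so the brackets vanish.\<close>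
  have comm: "Y u r (b * x) (Y v s (b' * x) w) = Y v s (b' * x) (Y u r (b * x) w)" for u r b v s b' w
  proof -
    have "b * x * (b' * x) = x * x * (b * b')" by (simp add: ac_simps)
    then have "Y u' r' (b * x * (b' * x)) w' = 0" for u' r' w'
      using K_mult[OF K] by (simp add: K_def)
    then show ?thesis using Y_Y[of u r "b * x" v s "b' * x" w] by (simp add: x)
  qed
  \<comment> \<open>All these operators are nilpotent on \<open>W\<close>, and the remaining
    \<open>Y v s (b * x)\<close> are linear combinations of them.\<close>
  define F where "F = {Y v s (b * x) | v s b. dot v s \<noteq> 0} \<union> {Z v s (b * x) | v s b. dot v s \<noteq> 0}"
  obtain B where B: "finite B" "W = complex_vector.span B" by (rule W_span)
  obtain w0 where w0: "w0 \<in> W" "w0 \<noteq> 0" by (rule W_nonzero)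
  have "\<exists>w\<in>W. w \<noteq> 0 \<and> (\<forall>f\<in>F. f w = 0)"
  proof (rule common_kernel[OF subspace_W eq_refl[OF B(2)] B(1)])
    show "W \<noteq> {0}" using w0 by blast
    show "clinear f" if "f \<in> F" for f
      using that by (auto simp: F_def clinear_Y) (simp add: clinear_iff Y_lin scaleC_add_right
        scaleC_scaleC mult.commute)
    show "f w \<in> W" if "f \<in> F" "w \<in> W" for f w
      using that by (auto simp: F_def intro!: Y_W complex_vector.subspace_add[OF subspace_W]
        complex_vector.subspace_scale[OF subspace_W])
    show "f (g w) = g (f w)" if "f \<in> F" "g \<in> F" for f g w
      using that by (auto simp: F_def Y_lin comm scaleC_add_right add_ac)
    show "\<exists>k. \<forall>w\<in>W. (f ^^ k) w = 0" if "f \<in> F" for f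
      using that nilpotent_Y[OF \<theta>] nilpotent_Z[OF \<theta>] by (auto simp: F_def)
  qed
  then obtain w where w: "w \<noteq> 0" "\<And>f. f \<in> F \<Longrightarrow> f w = 0" by blast
  have Y1: "Y v s (b * x) w = 0" if "dot v s \<noteq> 0" for v s b
    using that by (intro w(2)) (auto simp: F_def)
  have Y0: "Y v 0 (b * x) w = 0" for v b
  proof (cases "v = 0")
    case False
    then obtain s where s: "dot v s \<noteq> 0" using exists_dot_notin[of v "{0}"] by blast
    then have "Z v s (b * x) \<in> F" unfolding F_def by blast
    from w(2)[OF this] show ?thesis using s by (simp add: Y1 dot_minus)
  qed (simp add: Y_zero)
  \<comment> \<open>If (v,s) = 0 with s nonzero, then v = (v + e_i) - e_i, where both terms pair
    nontrivially with s for a suitable i.\<close>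
  have Y: "Y v s (b * x) w = 0" for v s b
  proof (cases "dot v s = 0 \<and> s \<noteq> 0")
    case True
    then obtain i where "s $ i \<noteq> 0" by (auto simp: vec_eq_iff)
    then have "dot (axis i 1) s \<noteq> 0"
      by (simp add: dot_def axis_def if_distrib[where f="\<lambda>x. x * _"] cong: if_cong)
    then have "Y (axis i 1) s (b * x) w = 0" "Y (v + axis i 1) s (b * x) w = 0"
      using True by (auto intro!: Y1 simp: dot_add_left)
    then show ?thesis by (simp add: Y_simps)
  qed (use Y0 Y1 in auto)
  have DD: "DD v s (b * x) w = T s (Y v s (b * x) w)" for v s b w
    by (simp add: Y_def T_T)
  have act: "act (X \<otimes> (b * x)) w = 0" for X b
    by (rule act_eq_0I) (simp_all add: act_tpow x DD Y T_lin flip: DD_def)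
  \<comment> \<open>These vectors form a submodule because brackets with \<tau> stay in the ideal
    generated by the \<open>X \<otimes> x\<close>.\<close>
  have "{w. \<forall>X b. act (X \<otimes> (b * x)) w = 0} = UNIV"
  proof (rule submodule_eq_UNIV[OF _ _ _ w(1)])
    show "complex_vector.subspace {w. \<forall>X b. act (X \<otimes> (b * x)) w = 0}"
      by (auto simp: complex_vector.subspace_def clinearD[OF clinear_act])
    show "w \<in> {w. \<forall>X b. act (X \<otimes> (b * x)) w = 0}" by (simp add: act)
    fix X b v assume v: "v \<in> {w. \<forall>X b. act (X \<otimes> (b * x)) w = 0}"
    have "act (X' \<otimes> (b' * x)) (act (X \<otimes> b) v) = 0" for X' b'
    proof -
      have "b' * x * b = b' * b * x" by (simp add: ac_simps)
      then show ?thesis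
        using act_bracket[of "X' \<otimes> (b' * x)" "X \<otimes> b" v] v
        by (simp add: lie_bracket_tens clinearD[OF clinear_act])
    qed
    then show "act (X \<otimes> b) v \<in> {w. \<forall>X b. act (X \<otimes> (b * x)) w = 0}" by blast
  qed
  then have "act (X \<otimes> (b * x)) w = 0" for X b w by blast
  from this[of _ 1] have "Y v t x w = 0" for v t w
    by (simp add: Y_def DD_def T_lin)
  then show ?thesis by (simp add: K_def x)
qed

text \<open>The cube of \<open>x\<close> lies in \<open>K\<close>, hence so does its fourth power;
  two uses of \<open>K_square\<close> descend to \<open>x\<close>.\<close>

lemma K_of_Y_eq_0:
  assumes x: "\<theta> x = 0" "\<And>w. w \<in> W \<Longrightarrow> Y v r x w = 0" and "v \<noteq> 0"
  shows "K x"
proof -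
  have "K (x * x * x)" using x(1) Y_eq_0I[OF x] assms(3) by (rule K_cube)
  from K_mult[OF this, of x] have "K ((x * x) * (x * x))" by (simp only: mult.assoc)
  then show ?thesis using K_square[of "x * x"] K_square[of x] x(1) by simp
qed

section \<open>The kernel of \<theta> acts by zero\<close>

lemma kernel_K:
  assumes m: "\<theta> m = 0" shows "K m"
proof (rule ccontr)
  assume "\<not> K m"
  obtain i :: 'n where True by blast
  define v :: "complex ^ 'n" where "v = axis i 1"
  have "v \<noteq> 0" by (simp add: v_def axis_eq_0_iff)
  have dot: "dot v (axis i k) = of_int k" for k by (simp add: v_def dot_axis)
  \<comment> \<open>Here \<open>dot v ?r = 1\<close>, so the commutator with \<open>?h\<close> acts
    on \<open>Y v ?r (b * m)\<close> by multiplying \<open>b\<close> by \<open>m\<close>.\<close>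
  let ?r = "axis i 1 :: int ^ 'n"
  let ?h = "Y v 0 m"
  have ad: "?h (Y v r (b * m) w) - Y v r (b * m) (?h w) = dot v r *\<^sub>C Y v r (m * (b * m)) w" for r b w
    using Y_Y[of v 0 m v r "b * m" w] by (simp add: m)
  obtain G where G: "finite G"
    "\<And>f. clinear f \<Longrightarrow> (\<And>w. w \<in> W \<Longrightarrow> f w \<in> W) \<Longrightarrow> restr W f \<in> complex_vector.span G"
    by (rule restr_finite_dimensional[OF finite_dimensional_W]) blast
  let ?T = "\<lambda>g. restr W (\<lambda>x. ?h (g x) - g (?h x))"
  let ?R = "\<lambda>b. restr W (Y v ?r (b * m))"
  have T: "?T (?R b) = ?R (m * b)" for b
    using ad[of ?r b] by (auto simp: restr_def fun_eq_iff Y_W dot scaleC_one mult.assoc)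
  \<comment> \<open>The operators \<open>?R b\<close> form a finite-dimensional space stable under
    the commutator; it is nonzero because \<open>m\<close> is not in \<open>K\<close>.\<close>
  have "\<exists>y\<in>range ?R. \<exists>c. y \<noteq> 0 \<and> ?T y = c *\<^sub>C y"
  proof (rule exists_eigenvector[OF _ _ _ G(1)])
    show "clinear ?T"
      by (auto simp: clinear_iff restr_def fun_eq_iff scaleC_fun_def Y_lin
          complex_vector.scale_right_diff_distrib)
    have "?R a + ?R b = ?R (a + b)" "c *\<^sub>C ?R a = ?R (c *\<^sub>C a)" "0 = ?R 0" for a b c
      by (auto simp: restr_def fun_eq_iff scaleC_fun_def distrib_right scaleC_mult_left Y_simps Y_zero)
    then show "complex_vector.subspace (range ?R)"
      unfolding complex_vector.subspace_def by (auto simp del: mult_zero_left)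
    show "?T g \<in> range ?R" if "g \<in> range ?R" for g using that T by auto
    show "range ?R \<subseteq> complex_vector.span G" using G(2)[OF clinear_Y Y_W] by auto
    show "?R 1 \<in> range ?R" by blast
    show "?R 1 \<noteq> 0"
    proof
      assume R: "?R 1 = 0"
      have "Y v ?r m w = 0" if "w \<in> W" for w
      proof -
        have "?R 1 w = 0" by (subst R) simp
        with that show ?thesis by (simp add: restr_def)
      qed
      then have "K m" using \<open>v \<noteq> 0\<close> by (rule K_of_Y_eq_0[OF m])
      with \<open>\<not> K m\<close> show False ..
    qed
  qed
  then obtain b \<alpha> where b: "?R b \<noteq> 0" "?T (?R b) = \<alpha> *\<^sub>C ?R b"
    by blast
  note Rb = b(2)[unfolded T]
  define e where "e = b * m"
  have "\<not> K e"
  proof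
    assume "K e"
    then have "?R b = 0" by (intro ext) (simp add: e_def K_def restr_def)
    with b(1) show False by blast
  qed
  \<comment> \<open>The eigenvalue equation makes the single operator
    \<open>Y v ?r (m * e - \<alpha> *\<^sub>C e)\<close> vanish on \<open>W\<close>, which is enough
    for membership in \<open>K\<close>.\<close>
  have "\<theta> (m * e - \<alpha> *\<^sub>C e) = 0" by (simp add: e_def m)
  moreover have "Y v ?r (m * e - \<alpha> *\<^sub>C e) w = 0" if "w \<in> W" for w
    using fun_cong[OF Rb, of w] that
    by (simp add: restr_def scaleC_fun_def Y_minus Y_simps e_def mult.assoc)
  ultimately have Kme: "K (m * e - \<alpha> *\<^sub>C e)"
    using \<open>v \<noteq> 0\<close> by (rule K_of_Y_eq_0)
  \<comment> \<open>For \<alpha> = 0 the square e^2 = (me)b would lie in \<open>K\<close>.\<close>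
  have "\<alpha> \<noteq> 0"
  proof
    assume "\<alpha> = 0"
    with Kme have "K (m * e)" by simp
    from K_mult[OF this, of b] have "K (e * e)" by (simp add: e_def ac_simps)
    with \<open>\<not> K e\<close> K_square[of e] show False by (simp add: e_def m)
  qed
  have me: "Y v t (m * e) w = \<alpha> *\<^sub>C Y v t e w" for t w
    using Kme by (simp add: K_def Y_minus Y_simps)
  \<comment> \<open>The commutator with \<open>?h\<close> multiplies these operators by the distinct
    values \<open>k * \<alpha>\<close>; once one of them vanishes, \<open>e\<close> lies in
    \<open>K\<close>.\<close>
  have "\<exists>k. \<forall>w\<in>W. Y v (axis i (int k)) e w = 0"
  proof (rule ad_eigenvectors_vanish[OF finite_dimensional_W clinear_Y Y_W clinear_Y Y_W])
    show "?h (Y v (axis i (int k)) e w) - Y v (axis i (int k)) e (?h w)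
      = (of_nat k * \<alpha>) *\<^sub>C Y v (axis i (int k)) e w" for k w
      using ad[of "axis i (int k)" b w] by (simp add: dot me scaleC_scaleC flip: e_def)
    show "inj (\<lambda>k. of_nat k * \<alpha>)" using \<open>\<alpha> \<noteq> 0\<close> by (auto intro: injI)
  qed
  then obtain k where "\<And>w. w \<in> W \<Longrightarrow> Y v (axis i (int k)) e w = 0" by blast
  then have "K e" using \<open>v \<noteq> 0\<close> by (intro K_of_Y_eq_0) (auto simp: e_def m)
  with \<open>\<not> K e\<close> show False ..
qed

section \<open>B acts through the character \<theta>\<close>

lemma act_eq: "act (X \<otimes> b) v = \<theta> b *\<^sub>C act (X \<otimes> 1) v"
proof -
  define m where "m = b - \<theta> b *\<^sub>C 1"
  have m: "\<theta> m = 0" by (simp add: m_def)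
  have "Y u r m v = 0" for u r
    using kernel_K[OF m] by (simp add: K_def)
  \<comment> \<open>\<open>T r\<close> inverts \<open>T (- r)\<close>, so the derivation operators
    themselves vanish.\<close>
  then have "T r (T (- r) (DD u r m v)) = 0" for u r
    by (simp add: Y_def T_lin)
  then have DD: "DD u r m v = 0" for u r
    by (simp add: T_T)
  have *: "act (X \<otimes> m) v = 0"
    by (rule act_eq_0I) (simp_all add: act_tpow m DD flip: DD_def)
  have "act (X \<otimes> (m + \<theta> b *\<^sub>C 1)) v = \<theta> b *\<^sub>C act (X \<otimes> 1) v"
    by (simp only: tens_simps(1,3) clinearD(1,2)[OF clinear_act_left] * add_0_left)
  then show ?thesis by (simp add: m_def)
qed

text \<open>By \<open>act_eq\<close> the factor from B contributes only a scalar, so a subspace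
  stable under all \<open>X \<otimes> 1\<close> is stable under all of \<tau>.\<close>

lemma irreducible_restrict: "irreducible_lie_module (\<lambda>X. act (X \<otimes> 1))"
  unfolding irreducible_lie_module_def
proof (intro conjI allI impI)
  show "lie_module (\<lambda>X. act (X \<otimes> 1))"
    unfolding lie_module_def cbilinear_def
  proof (intro conjI allI)
    show "clinear (act (X \<otimes> 1))" for X by (rule clinear_act)
    show "clinear (\<lambda>X. act (X \<otimes> 1) v)" for v
      by (simp add: clinear_iff tens_simps clinearD(1,2)[OF clinear_act_left])
    show "act (\<lbrakk>X, X'\<rbrakk>\<^sub>L \<otimes> 1) v
      = act (X \<otimes> 1) (act (X' \<otimes> 1) v) - act (X' \<otimes> 1) (act (X \<otimes> 1) v)" for X X' v
      by (subst act_bracket) (simp add: lie_bracket_tens)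
  qed
  show "(UNIV :: 'v set) \<noteq> {0}" using exists_nonzero by auto
  fix S assume S: "lie_submodule (\<lambda>X. act (X \<otimes> 1)) S"
  then have sub: "complex_vector.subspace S" by (simp add: lie_submodule_def)
  have "act (X \<otimes> b) w \<in> S" if "w \<in> S" for X b w
  proof (subst act_eq, rule complex_vector.subspace_scale[OF sub])
    show "act (X \<otimes> 1) w \<in> S" using S that unfolding lie_submodule_def by blast
  qed
  then show "S = {0} \<or> S = UNIV"
    using submodule_eq_UNIV[OF sub] complex_vector.subspace_0[OF sub] by blast
qed

end

theorem theorem3p1:
  fixes act :: "('n::finite, 'b::complex_comm_algebra) tau \<Rightarrow> 'v::complex_vector \<Rightarrow> 'v"
  assumes "finitely_generated_algebra TYPE('b)"
    and "irreducible_lie_module act"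
    and "weight_module act"
    and "\<forall>l \<in> dual_of cartan. finite_dimensional (weight_space act l)"
    and "associative_action act"
    and "\<forall>v. act (inA (tpow 0) \<otimes> 1) v = v"
  shows "irreducible_lie_module (\<lambda>X :: 'n ader. act (X \<otimes> 1))"
proof -
  interpret tau_module act
    by unfold_locales (use assms in \<open>auto simp: associative_action_def\<close>)
  show ?thesis by (rule irreducible_restrict)
qed

end
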